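(* If a graph $G$ has a clean binary pear tree $(T, \mathcal{B})$, then $G$ has a minor $H$ such that $H$ has a clean binary ear tree $(T, \mathcal{P})$ (indexed by the same binary tree $T$).
   Context: All graphs are finite and simple; after contracting an edge, parallel edges and loops are suppressed. The length of a path is its number of edges. If $H$ is a subgraph of $G$, an $H$-ear is a path in $G$ with both ends in $V(H)$ and no internal vertex in $V(H)$. A binary tree is a rooted tree in which every vertex has at most two children; $T_x$ denotes the subtree rooted at $x$. A binary ear tree in $G$ is a pair $(T,\mathcal{P})$ with $T$ a binary tree and $\mathcal{P}=\{P_x:x\in V(T)\}$ paths in $G$ of length at least $2$ such that for every non-root $x$ with parent $y$: $P_x$ is a $P_y$-ear, and no internal vertex of $P_x$ lies in $\bigcup_{z\in V(T)\setminus V(T_x)}V(P_z)$; it is clean if for every non-leaf $y$ some end of $P_y$ is not contained in any $P_x$ with $x$ a child of $y$. A binary pear tree in $G$ is a pair $(T,\mathcal{B})$ with $T$ a binary tree and $\mathcal{B}=\{(P_x,Q_x):x\in V(T)\}$ pairs of paths in $G$ of length at least $2$ with $P_x\subseteq Q_x$, such that for every non-root $x$ with parent $y$: (1) $Q_x$ is a $P_y$-ear; (2) if $x$ has no sibling, no internal vertex of $Q_x$ lies in $\bigcup_{z\in V(T)\setminus V(T_x)}V(Q_z)$; (3) if $x$ has a sibling $x'$, then no internal vertex of $Q_x$ lies in $\bigcup_{z\in V(T)\setminus(V(T_x)\cup V(T_{x'}))}V(Q_z)$, and no internal vertex of $P_x$ lies in $Q_{x'}$. It is clean if for every non-leaf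 $y$ of $T$ some end of $P_y$ is not contained in any $Q_x$ with $x$ a child of $y$. *)

theory Defs
  imports "Graph_Theory.Graph_Theory"
begin

text \<open>
  A finite simple graph is a \<^locale>\<open>pair_graph\<close>: an undirected edge \<open>uv\<close> is the pair of opposite
  arcs \<open>(u, v)\<close>, \<open>(v, u)\<close>. A path is a \<^const>\<open>vpath\<close>, i.e. a nonempty list of distinct, consecutively
  adjacent vertices, and its length is \<^const>\<open>vwalk_length\<close>.
\<close>

definition path_graph :: "'a list \<Rightarrow> 'a pair_pre_digraph" where
  "path_graph p = \<lparr> pverts = set p, parcs = set (vwalk_arcs p) \<union> (set (vwalk_arcs p))\<inverse> \<rparr>"

definition internal_verts :: "'a list \<Rightarrow> 'a set" where
  "internal_verts p = set p - {hd p, last p}"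

definition is_ear :: "'a pair_pre_digraph \<Rightarrow> 'a pair_pre_digraph \<Rightarrow> 'a list \<Rightarrow> bool" where
  "is_ear G H p \<longleftrightarrow>
     vpath p (with_proj G) \<and> hd p \<in> pverts H \<and> last p \<in> pverts H \<and>
     internal_verts p \<inter> pverts H = {}"


text \<open>
  Contracting \<open>uv\<close> merges \<open>v\<close> into \<open>u\<close>; loops are discarded, and parallel edges cannot arise since
  arcs are pairs of vertices.
\<close>

definition contract_edge :: "'a pair_pre_digraph \<Rightarrow> 'a \<Rightarrow> 'a \<Rightarrow> 'a pair_pre_digraph" where
  "contract_edge G u v =
     (let f = (\<lambda>w. if w = v then u else w)
      in \<lparr> pverts = f ` pverts G,
           parcs = {(f a, f b) | a b. (a, b) \<in> parcs G \<and> f a \<noteq> f b} \<rparr>)"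

definition contract_step :: "'a pair_pre_digraph \<Rightarrow> 'a pair_pre_digraph \<Rightarrow> bool" where
  "contract_step G H \<longleftrightarrow> (\<exists>u v. (u, v) \<in> parcs G \<and> H = contract_edge G u v)"

text \<open>
  The subgraph \<open>S\<close> is required to be a \<^locale>\<open>pair_graph\<close> because \<^const>\<open>subgraph\<close> is a notion for
  digraphs and does not by itself preserve symmetry.
\<close>

definition is_minor :: "'b pair_pre_digraph \<Rightarrow> 'a pair_pre_digraph \<Rightarrow> bool" where
  "is_minor H G \<longleftrightarrow>
     (\<exists>S K. pair_graph S \<and> subgraph (with_proj S) (with_proj G) \<and>
            contract_step\<^sup>*\<^sup>* S K \<and> digraph_iso (with_proj K) (with_proj H))"


text \<open>
  The constant \<^const>\<open>tree\<close> is not usable for undirected trees: its notion of cycle counts the closed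
  walk \<open>u, v, u\<close> along a single edge.
\<close>

definition undirected_tree :: "'a pair_pre_digraph \<Rightarrow> bool" where
  "undirected_tree T \<longleftrightarrow>
     pair_graph T \<and> Digraph_Component.connected (with_proj T) \<and>
     \<not> (\<exists>c. vpath c (with_proj T) \<and> length c \<ge> 3 \<and> (last c, hd c) \<in> parcs T)"

definition subtree_verts :: "'a pair_pre_digraph \<Rightarrow> 'a \<Rightarrow> 'a \<Rightarrow> 'a set" where
  "subtree_verts T r x =
     {z. \<exists>p. vpath p (with_proj T) \<and> hd p = r \<and> last p = z \<and> x \<in> set p}"

definition children :: "'a pair_pre_digraph \<Rightarrow> 'a \<Rightarrow> 'a \<Rightarrow> 'a set" where
  "children T r y = {x. (y, x) \<in> parcs T \<and> x \<in> subtree_verts T r y}"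

definition binary_tree :: "'a pair_pre_digraph \<Rightarrow> 'a \<Rightarrow> bool" where
  "binary_tree T r \<longleftrightarrow>
     undirected_tree T \<and> r \<in> pverts T \<and> (\<forall>y \<in> pverts T. card (children T r y) \<le> 2)"


text \<open>
  In the following, \<open>T\<close> is a tree with root \<open>r\<close>, and \<open>y\<close>, \<open>x\<close> range over the pairs of a parent and
  its child, so that \<open>x\<close> ranges over all non-root vertices.
\<close>

definition binary_ear_tree ::
  "'a pair_pre_digraph \<Rightarrow> 'b pair_pre_digraph \<Rightarrow> 'b \<Rightarrow> ('b \<Rightarrow> 'a list) \<Rightarrow> bool" where
  "binary_ear_tree G T r P \<longleftrightarrow>
     binary_tree T r \<and>
     (\<forall>x \<in> pverts T. vpath (P x) (with_proj G) \<and> vwalk_length (P x) \<ge> 2) \<and>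
     (\<forall>y \<in> pverts T. \<forall>x \<in> children T r y.
        is_ear G (path_graph (P y)) (P x) \<and>
        internal_verts (P x) \<inter> (\<Union>z \<in> pverts T - subtree_verts T r x. set (P z)) = {})"

definition clean_binary_ear_tree ::
  "'a pair_pre_digraph \<Rightarrow> 'b pair_pre_digraph \<Rightarrow> 'b \<Rightarrow> ('b \<Rightarrow> 'a list) \<Rightarrow> bool" where
  "clean_binary_ear_tree G T r P \<longleftrightarrow>
     binary_ear_tree G T r P \<and>
     (\<forall>y \<in> pverts T. children T r y \<noteq> {} \<longrightarrow>
        (\<exists>e \<in> {hd (P y), last (P y)}. \<forall>x \<in> children T r y. e \<notin> set (P x)))"

definition binary_pear_tree ::
  "'a pair_pre_digraph \<Rightarrow> 'b pair_pre_digraph \<Rightarrow> 'b \<Rightarrow> ('b \<Rightarrow> 'a list \<times> 'a list) \<Rightarrow> bool" where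
  "binary_pear_tree G T r B \<longleftrightarrow>
     (let P = (\<lambda>x. fst (B x)); Q = (\<lambda>x. snd (B x)) in
     binary_tree T r \<and>
     (\<forall>x \<in> pverts T.
        vpath (P x) (with_proj G) \<and> vwalk_length (P x) \<ge> 2 \<and>
        vpath (Q x) (with_proj G) \<and> vwalk_length (Q x) \<ge> 2 \<and>
        subgraph (with_proj (path_graph (P x))) (with_proj (path_graph (Q x)))) \<and>
     (\<forall>y \<in> pverts T. \<forall>x \<in> children T r y.
        is_ear G (path_graph (P y)) (Q x) \<and>
        (children T r y = {x} \<longrightarrow>
           internal_verts (Q x) \<inter> (\<Union>z \<in> pverts T - subtree_verts T r x. set (Q z)) = {}) \<and>
        (\<forall>x' \<in> children T r y. x' \<noteq> x \<longrightarrow>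
           internal_verts (Q x) \<inter>
             (\<Union>z \<in> pverts T - (subtree_verts T r x \<union> subtree_verts T r x'). set (Q z)) = {} \<and>
           internal_verts (P x) \<inter> set (Q x') = {})))"

definition clean_binary_pear_tree ::
  "'a pair_pre_digraph \<Rightarrow> 'b pair_pre_digraph \<Rightarrow> 'b \<Rightarrow> ('b \<Rightarrow> 'a list \<times> 'a list) \<Rightarrow> bool" where
  "clean_binary_pear_tree G T r B \<longleftrightarrow>
     binary_pear_tree G T r B \<and>
     (\<forall>y \<in> pverts T. children T r y \<noteq> {} \<longrightarrow>
        (\<exists>e \<in> {hd (fst (B y)), last (fst (B y))}. \<forall>x \<in> children T r y. e \<notin> set (snd (B x))))"

end

theory Submission
  imports Defs "HOL-Library.Sublist"
begin

text \<open>
  If the paths \<open>Q x\<close> of any two siblings are internally disjoint, then the paths \<open>Q x\<close> themselves form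
  a clean binary ear tree. Otherwise the total length of the \<open>Q x\<close> can be decreased. Let \<open>Q x\<close> and
  \<open>Q x'\<close> be intersecting \<open>P y\<close>-ears,
    and let \<open>a a1\<close> be an end edge of \<open>Q x\<close> outside \<open>P x\<close>, with \<open>a\<close> on
  \<open>P y\<close>. If \<open>a1\<close> is not on \<open>Q x'\<close>, contract \<open>a a1\<close>. If it is, then (unless \<open>a\<close> is the end of \<open>Q x'\<close>
  lying on the other side of \<open>P x'\<close>) \<open>Q x'\<close> can leave at \<open>a1\<close> directly to \<open>a\<close>, after which \<open>a a1\<close> can
  again be contracted. When all such moves fail, both ears have the same ends \<open>a\<close>, \<open>b\<close>, and \<open>Q x'\<close>
  ends with an edge \<open>u b\<close> such that \<open>u\<close> lies on the segment of \<open>Q x\<close> from \<open>a\<close> to \<open>P x\<close>. Then the segment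
  of \<open>P y\<close> between \<open>a\<close> and \<open>b\<close> is replaced by the segment of \<open>Q x\<close> from \<open>a\<close> to \<open>u\<close> followed
    by \<open>u b\<close>,
  and both ears are shortened to end on it. The minor is obtained by contractions alone.
\<close>

section \<open>Lists and paths\<close>

lemma vwalk_arcs_subset_iff:
  "set (vwalk_arcs p) \<subseteq> E \<longleftrightarrow> successively (\<lambda>u v. (u, v) \<in> E) p"
  by (induct p rule: vwalk_arcs.induct) auto

lemma vpath_with_proj_iff:
  "vpath p (with_proj G) \<longleftrightarrow>
     p \<noteq> [] \<and> distinct p \<and> set p \<subseteq> pverts G \<and> successively (\<lambda>u v. (u, v) \<in> parcs G) p"
  by (auto simp: vpath_def vwalk_def vwalk_arcs_subset_iff)

lemma vpath_sublist:
  assumes "vpath q (with_proj G)" "sublist p q" "p \<noteq> []"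
  shows "vpath p (with_proj G)"
  using assms by (auto simp: vpath_with_proj_iff sublist_def successively_append_iff)

lemma vpath_rev:
  assumes "pair_graph G" "vpath p (with_proj G)"
  shows "vpath (rev p) (with_proj G)"
proof -
  interpret pair_graph G by fact
  have "successively (\<lambda>u v. (v, u) \<in> parcs G) p"
    using assms(2) arcs_symmetric
    by (auto simp: vpath_with_proj_iff intro: successively_mono)
  then show ?thesis using assms(2) by (auto simp: vpath_with_proj_iff)
qed

lemma internal_verts_rev [simp]: "internal_verts (rev p) = internal_verts p"
  by (cases "p = []") (auto simp: internal_verts_def hd_rev last_rev)

lemma internal_verts_mono_sublist:
  assumes "distinct q" "sublist p q" "p \<noteq> []"
  shows "internal_verts p \<subseteq> internal_verts q"
proof -
  obtain A B where q: "q = A @ p @ B" using assms(2) by (auto simp: sublist_def)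
  have "hd q = hd p \<or> hd q \<in> set A"
    using assms(3) by (cases A) (auto simp: q)
  moreover have "last q = last p \<or> last q \<in> set B"
    using assms(3) by (cases B rule: rev_cases) (auto simp: q)
  ultimately show ?thesis using assms(1) by (auto simp: internal_verts_def q)
qed

lemma split_list_two:
  assumes "a \<in> set p" "b \<in> set p" "a \<noteq> b"
  shows "\<exists>s t l. p = s @ a # t @ b # l \<or> p = s @ b # t @ a # l"
proof -
  obtain s l where p: "p = s @ a # l" using assms(1) by (meson split_list)
  then consider "b \<in> set s" | "b \<in> set l" using assms(2,3) by auto
  then show ?thesis
    by cases (metis append.assoc append_Cons p split_list, metis p split_list)
qed

text \<open>A segment with elements on both sides of \<open>c\<close> would have \<open>c\<close> in
  its interior. In the applications \<open>c\<close> is a vertex of the sibling ear, kept off the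
  interior of \<open>p\<close> by condition (3).\<close>

lemma sublist_around_split:
  assumes "distinct (C @ c # D)" "sublist p (C @ c # D)" "c \<notin> internal_verts p"
  shows "sublist p (C @ [c]) \<or> sublist p (c # D)"
proof -
  obtain A B where q: "C @ c # D = A @ p @ B" using assms(2) by (auto simp: sublist_def)
  then consider (A) E where "A = C @ c # E" "D = E @ p @ B"
    | (pB) E where "C = A @ E" "c # D = E @ p @ B" "E = []"
    | (pin) E where "C = A @ E" "E @ c # D = p @ B" "E \<noteq> []"
    by (fastforce simp: append_eq_append_conv2 Cons_eq_append_conv)
  then show ?thesis
  proof cases
    case A
    then have "c # D = (c # E) @ p @ B" by simp
    then show ?thesis by (metis sublist_appendI)
  next
    case pB
    then show ?thesis by (metis append_Nil sublist_append_rightI)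
  next
    case pin
    show ?thesis
    proof (cases "c \<in> set p")
      case True
      have d: "distinct (E @ c # D)" using assms(1) pin by auto
      obtain p1 p2 where p: "p = p1 @ c # p2" using True by (meson split_list)
      have "c \<notin> set E" "c \<notin> set D" using d by auto
      then have "E = p1" "D = p2 @ B" using pin(2) p append_Cons_eq_iff[of c E D p1 "p2 @ B"]
        by auto
      \<comment> \<open>\<open>E\<close> is nonempty, so \<open>p\<close> starts strictly before
        \<open>c\<close>, and \<open>c\<close> can only be its last element.\<close>
      then have "c \<noteq> hd p" using p d pin by (cases p1) auto
      then have "c = last p" using True assms(3) by (auto simp: internal_verts_def)
      then have "p2 = []"
        using p \<open>D = p2 @ B\<close> \<open>c \<notin> set D\<close> by (cases p2 rule: rev_cases) auto
      then have "C @ [c] = A @ p" using pin(1) p \<open>E = p1\<close> by simp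
      then show ?thesis by simp
    next
      case False
      then obtain F where "E = p @ F"
        using pin(2) by (auto simp: append_eq_append_conv2 Cons_eq_append_conv)
      then have "C @ [c] = A @ p @ (F @ [c])" using pin by simp
      then show ?thesis by (metis sublist_appendI)
    qed
  qed
qed

text \<open>Extending \<open>p\<close> inside \<open>q\<close> on each side until it first hits
  \<open>W\<close> gives \<open>l\<close>; an end already in \<open>W\<close> stays. This cuts an
  ear back to the piece around its inner path that ends on a rerouted path.\<close>

lemma shrink_to_ends_in:
  assumes "sublist p q" "p \<noteq> []" "hd q \<in> W" "last q \<in> W" "internal_verts p \<inter> W = {}"
  obtains l where "sublist l q" "sublist p l" "hd l \<in> W" "last l \<in> W" "internal_verts l \<inter> W = {}"
proof -
  obtain A B where q: "q = A @ p @ B" using assms(1) by (auto simp: sublist_def)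
  have "\<exists>x \<in> set (A @ [hd p]). x \<in> W"
    using assms(2,3) q by (cases A) auto
  from split_list_last_prop[OF this] obtain A1 s A2
    where A: "A @ [hd p] = A1 @ s # A2" "s \<in> W" "\<forall>x \<in> set A2. x \<notin> W"
    by blast
  have "\<exists>x \<in> set (last p # B). x \<in> W"
    using assms(2,4) q by (cases B rule: rev_cases) auto
  from split_list_first_prop[OF this] obtain B1 t B2
    where B: "last p # B = B1 @ t # B2" "t \<in> W" "\<forall>x \<in> set B1. x \<notin> W"
    by blast
  obtain A' where A': "s # A2 = A' @ [hd p]" "A = A1 @ A'"
    using A(1) by (cases A2 rule: rev_cases) auto
  obtain B' where B': "B1 @ [t] = last p # B'" "B = B' @ B2"
    using B(1) by (cases B1) auto
  define l where "l = A' @ p @ B'"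
  have hdl: "hd l = s" using A'(1) assms(2) by (cases A') (auto simp: l_def)
  have lastl: "last l = t" using B'(1) assms(2)
    by (cases B' rule: rev_cases) (auto simp: l_def append_eq_Cons_conv)
  have "x \<notin> W" if x: "x \<in> set l" "x \<noteq> s" "x \<noteq> t" for x
  proof -
    consider "x \<in> set (A' @ [hd p])" | "x \<in> set (last p # B')" | "x \<in> internal_verts p"
      using x(1) by (auto simp: l_def internal_verts_def)
    then show ?thesis
    proof cases
      case 1
      then show ?thesis using x(2) A(3) unfolding A'(1)[symmetric] by auto
    next
      case 2
      then show ?thesis using x(3) B(3) unfolding B'(1)[symmetric] by auto
    next
      case 3
      then show ?thesis using assms(5) by auto
    qed
  qed
  then have "internal_verts l \<inter> W = {}" by (auto simp: internal_verts_def hdl lastl)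
  moreover have "q = A1 @ l @ B2" using q A'(2) B'(2) by (simp add: l_def)
  then have "sublist l q" by simp
  moreover have "sublist p l" by (simp add: l_def)
  ultimately show ?thesis using that A(2) B(2) hdl lastl by auto
qed

lemma in_set_vwalk_arcsD: "(a, b) \<in> set (vwalk_arcs q) \<Longrightarrow> \<exists>X Y. q = X @ a # b # Y"
proof (induct q rule: vwalk_arcs.induct)
  case (3 x y xs)
  then show ?case by (auto intro: exI[of _ "[]"]) (metis append_Cons)
qed auto

text \<open>The direction of travel propagates: an arc of \<open>p\<close> leaving \<open>v\<close>
  against the order of \<open>q\<close> would lead back to \<open>u\<close>, which distinctness
  forbids.\<close>

lemma subpath_extends:
  assumes "distinct q" "q = X @ u # v # Y" "distinct (u # v # p)"
    and "set (vwalk_arcs (v # p)) \<subseteq> set (vwalk_arcs q) \<union> (set (vwalk_arcs q))\<inverse>"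
  shows "\<exists>Z. q = X @ (u # v # p) @ Z"
  using assms(2-)
proof (induct p arbitrary: X u v Y)
  case (Cons w p)
  have "(v, w) \<in> set (vwalk_arcs q) \<or> (w, v) \<in> set (vwalk_arcs q)" using Cons.prems(3) by auto
  then show ?case
  proof
    assume "(v, w) \<in> set (vwalk_arcs q)"
    then obtain X' Y' where q: "q = X' @ v # w # Y'" using in_set_vwalk_arcsD by metis
    have "v \<notin> set X'" "v \<notin> set (w # Y')" using assms(1) q by auto
    then have "X' = X @ [u]" using append_Cons_eq_iff[of v X' "w # Y'" "X @ [u]" Y] Cons.prems(1) q
      by auto
    then obtain Z where "q = (X @ [u]) @ (v # w # p) @ Z"
      using Cons.hyps[of "X @ [u]" v w Y'] q Cons.prems by auto
    then show ?thesis by auto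
  next
    assume "(w, v) \<in> set (vwalk_arcs q)"
    then obtain X' Y' where q: "q = X' @ w # v # Y'" using in_set_vwalk_arcsD by metis
    then have "v \<notin> set (X' @ [w])" "v \<notin> set Y'" using assms(1) q by auto
    then have "X' @ [w] = X @ [u]"
      using append_Cons_eq_iff[of v "X' @ [w]" Y' "X @ [u]" Y] Cons.prems(1) q by auto
    then show ?thesis using Cons.prems(2) by auto
  qed
qed auto

text \<open>Turns containment of path graphs into a relation of lists. The first arc of
  \<open>p\<close> decides between \<open>q\<close> and \<open>rev q\<close>.\<close>

lemma subpath_sublist:
  assumes "distinct p" "distinct q" "length p \<ge> 2"
    and "set (vwalk_arcs p) \<subseteq> set (vwalk_arcs q) \<union> (set (vwalk_arcs q))\<inverse>"
  shows "sublist p q \<or> sublist p (rev q)"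
proof -
  obtain u v p' where p: "p = u # v # p'" using assms(3) by (cases p; cases "tl p") auto
  have conv: "set (vwalk_arcs (rev q)) = (set (vwalk_arcs q))\<inverse>" by (auto simp: set_vwalk_arcs_rev)
  have ext: "sublist p q'" if q'_facts: "distinct q'" "(u, v) \<in> set (vwalk_arcs q')"
    "set (vwalk_arcs p) \<subseteq> set (vwalk_arcs q') \<union> (set (vwalk_arcs q'))\<inverse>" for q'
  proof -
    obtain X Y where q': "q' = X @ u # v # Y" using q'_facts(2) in_set_vwalk_arcsD by metis
    then obtain Z where "q' = X @ p @ Z"
      using subpath_extends[OF q'_facts(1) q', of p'] assms(1) q'_facts(3) p by auto
    then show ?thesis by simp
  qed
  have "(u, v) \<in> set (vwalk_arcs q) \<or> (u, v) \<in> set (vwalk_arcs (rev q))" using assms(4) conv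
    by (auto simp: p)
  then show ?thesis using ext[of q] ext[of "rev q"] assms(2,4) conv by auto
qed

section \<open>Contractions\<close>

text \<open>The vertex map inside \<open>contract_edge\<close>, named so that it can be mapped along
  paths.\<close>

definition merge :: "'a \<Rightarrow> 'a \<Rightarrow> 'a \<Rightarrow> 'a" where
  "merge u v w = (if w = v then u else w)"

lemma contract_edge_simps [simp]:
  "pverts (contract_edge G u v) = merge u v ` pverts G"
  "parcs (contract_edge G u v) =
     {(merge u v a, merge u v b) | a b. (a, b) \<in> parcs G \<and> merge u v a \<noteq> merge u v b}"
  by (auto simp: contract_edge_def Let_def merge_def)

lemma merge_eq_iff: "merge u v a = merge u v b \<longleftrightarrow> a = b \<or> {a, b} = {u, v}"
  by (auto simp: merge_def)

lemma pair_graph_contract_edge: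
  assumes "pair_graph G"
  shows "pair_graph (contract_edge G u v)"
proof -
  interpret pair_graph G by fact
  have "parcs (contract_edge G u v) \<subseteq> map_prod (merge u v) (merge u v) ` parcs G" by auto
  then have fin: "finite (parcs (contract_edge G u v))"
    using pair_finite_arcs finite_surj by blast
  show ?thesis
  proof
    show "symmetric (with_proj (contract_edge G u v))"
      using arcs_symmetric by (fastforce simp: symmetric_def sym_def)
  qed (use fin pair_finite_verts in \<open>auto dest: wellformed'\<close>)
qed

text \<open>\<open>merge\<close> identifies only \<open>u\<close> and \<open>v\<close>. It is
  therefore injective on a path missing one of them, and no arc of the path becomes a discarded
  loop.\<close>

lemma vpath_map_merge:
  assumes "pair_graph G" "vpath p (with_proj G)" "\<not> {u, v} \<subseteq> set p"
  shows "vpath (map (merge u v) p) (with_proj (contract_edge G u v))"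
proof -
  interpret pair_graph G by fact
  have inj: "inj_on (merge u v) (set p)"
    using assms(3) by (auto simp: inj_on_def merge_eq_iff doubleton_eq_iff)
  have "successively (\<lambda>a b. (merge u v a, merge u v b) \<in> parcs (contract_edge G u v)) p"
    using assms(2) inj_onD[OF inj] no_loops'
    by (fastforce simp: vpath_with_proj_iff elim!: successively_mono)
  then show ?thesis
    using assms(2) inj by (auto simp: vpath_with_proj_iff distinct_map successively_map)
qed


section \<open>Pear trees over a parent-child relation\<close>

text \<open>The reduction sees the tree only through \<open>R\<close>, which stays fixed while the
  graph and the paths change; \<open>R\<^sup>+\<close> is proper descent.\<close>

locale binary_forest =
  fixes V :: "'b set" and R :: "'b rel"
  assumes finite_V: "finite V"
    and R_subset: "R \<subseteq> V \<times> V"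
    and acyclic_R: "acyclic R"
    and parent_unique: "(y, x) \<in> R \<Longrightarrow> (y', x) \<in> R \<Longrightarrow> y = y'"
    and at_most_two_children:
      "(y, x) \<in> R \<Longrightarrow> (y, x') \<in> R \<Longrightarrow> x \<noteq> x' \<Longrightarrow> (y, z) \<in> R \<Longrightarrow> z = x \<or> z = x'"
begin

lemma in_V: "(y, x) \<in> R \<Longrightarrow> y \<in> V" "(y, x) \<in> R \<Longrightarrow> x \<in> V"
  using R_subset by auto

lemma not_descendant_self: "(x, x) \<notin> R\<^sup>+"
  using acyclic_R by (simp add: acyclic_def)

text \<open>A chain descending from \<open>y\<close> to \<open>z\<close> must enter \<open>z\<close>
  through its only parent \<open>t\<close>.\<close>

lemma parent_of_descendant:
  assumes "(t, z) \<in> R" "(y, z) \<in> R\<^sup>+"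
  shows "t = y \<or> (y, t) \<in> R\<^sup>+"
  using assms(2) by (cases rule: tranclE) (use assms(1) parent_unique in blast)+

lemma sibling_not_descendant:
  assumes "(y, x) \<in> R" "(y, x') \<in> R"
  shows "(x, x') \<notin> R\<^sup>+"
proof
  assume "(x, x') \<in> R\<^sup>+"
  then have "y = x \<or> (x, y) \<in> R\<^sup>+" using assms(2) parent_of_descendant by blast
  then show False using assms(1) not_descendant_self
    by (metis trancl.r_into_trancl trancl_into_trancl)
qed

lemma parent_not_descendant: "(y, x) \<in> R \<Longrightarrow> (x, y) \<notin> R\<^sup>+"
  using not_descendant_self by (meson trancl_into_trancl)

lemma descendant_antisym: "(y, x) \<in> R\<^sup>+ \<Longrightarrow> (x, y) \<notin> R\<^sup>+"
  using not_descendant_self by (meson trancl_trans)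

text \<open>
  \<open>R\<close> holds the pairs of a parent and its child.
  With at most two children per node, conditions (2) and (3) on the internal vertices of \<open>Q x\<close>
  both say that they avoid \<open>Q z\<close> unless \<open>z\<close> is a proper descendant of the parent of \<open>x\<close>.
\<close>

definition pear :: "'a pair_pre_digraph \<Rightarrow> ('b \<Rightarrow> 'a list) \<Rightarrow> ('b \<Rightarrow> 'a list) \<Rightarrow> bool" where
  "pear G P Q \<longleftrightarrow>
     (\<forall>x \<in> V. vpath (Q x) (with_proj G) \<and> length (P x) \<ge> 3 \<and> sublist (P x) (Q x)) \<and>
     (\<forall>y x. (y, x) \<in> R \<longrightarrow> hd (Q x) \<in> set (P y) \<and> last (Q x) \<in> set (P y)) \<and>
     (\<forall>y x z v. (y, x) \<in> R \<longrightarrow> z \<in> V \<longrightarrow> (y, z) \<notin> R\<^sup>+ \<longrightarrow>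
        v \<in> internal_verts (Q x) \<longrightarrow> v \<notin> set (Q z)) \<and>
     (\<forall>y x x' v. (y, x) \<in> R \<longrightarrow> (y, x') \<in> R \<longrightarrow> x \<noteq> x' \<longrightarrow>
        v \<in> internal_verts (P x) \<longrightarrow> v \<notin> set (Q x')) \<and>
     (\<forall>y \<in> V. \<exists>e \<in> {hd (P y), last (P y)}. \<forall>x. (y, x) \<in> R \<longrightarrow> e \<notin> set (Q x))"

text \<open>The proofs by \<open>goal_cases\<close> refer to these premises by position: 4 and 5
  concern the ends of ears, 6 the disjointness from non-descendants of the parent, 7 the siblings
  and 8 cleanness.\<close>

lemma pearI:
  assumes "\<And>x. x \<in> V \<Longrightarrow> vpath (Q x) (with_proj G)"
    and "\<And>x. x \<in> V \<Longrightarrow> length (P x) \<ge> 3"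
    and "\<And>x. x \<in> V \<Longrightarrow> sublist (P x) (Q x)"
    and "\<And>y x. (y, x) \<in> R \<Longrightarrow> hd (Q x) \<in> set (P y)"
    and "\<And>y x. (y, x) \<in> R \<Longrightarrow> last (Q x) \<in> set (P y)"
    and "\<And>y x z v. (y, x) \<in> R \<Longrightarrow> z \<in> V \<Longrightarrow> (y, z) \<notin> R\<^sup>+ \<Longrightarrow> v \<in> internal_verts (Q x) \<Longrightarrow>
           v \<in> set (Q z) \<Longrightarrow> False"
    and "\<And>y x x' v. (y, x) \<in> R \<Longrightarrow> (y, x') \<in> R \<Longrightarrow> x \<noteq> x' \<Longrightarrow> v \<in> internal_verts (P x) \<Longrightarrow>
           v \<in> set (Q x') \<Longrightarrow> False"
    and "\<And>y. y \<in> V \<Longrightarrow> \<exists>e \<in> {hd (P y), last (P y)}. \<forall>x. (y, x) \<in> R \<longrightarrow> e \<notin> set (Q x)"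
  shows "pear G P Q"
  using assms unfolding pear_def by blast

section \<open>Consequences of the pear tree conditions\<close>

context
  fixes G :: "'a pair_pre_digraph" and P Q
  assumes pear: "pear G P Q"
begin

lemma pear_vpath: "x \<in> V \<Longrightarrow> vpath (Q x) (with_proj G)"
  and pear_length: "x \<in> V \<Longrightarrow> length (P x) \<ge> 3"
  and pear_sublist: "x \<in> V \<Longrightarrow> sublist (P x) (Q x)"
  and pear_hd: "(y, x) \<in> R \<Longrightarrow> hd (Q x) \<in> set (P y)"
  and pear_last: "(y, x) \<in> R \<Longrightarrow> last (Q x) \<in> set (P y)"
  and pear_clean: "y \<in> V \<Longrightarrow> \<exists>e \<in> {hd (P y), last (P y)}. \<forall>x. (y, x) \<in> R \<longrightarrow> e \<notin> set (Q x)"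
  using pear unfolding pear_def by blast+

lemma pear_internal:
  "(y, x) \<in> R \<Longrightarrow> z \<in> V \<Longrightarrow> (y, z) \<notin> R\<^sup>+ \<Longrightarrow> v \<in> internal_verts (Q x) \<Longrightarrow> v \<in> set (Q z) \<Longrightarrow> False"
  using pear unfolding pear_def by blast

lemma pear_sibling:
  "(y, x) \<in> R \<Longrightarrow> (y, x') \<in> R \<Longrightarrow> x \<noteq> x' \<Longrightarrow> v \<in> internal_verts (P x) \<Longrightarrow> v \<in> set (Q x') \<Longrightarrow> False"
  using pear unfolding pear_def by blast

lemma pear_nonempty:
  assumes "x \<in> V"
  shows "P x \<noteq> []" "Q x \<noteq> []"
  using pear_length[OF assms] pear_vpath[OF assms] by (auto simp: vpath_with_proj_iff)

lemma pear_distinct: "x \<in> V \<Longrightarrow> distinct (Q x)"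
  using pear_vpath by (simp add: vpath_with_proj_iff)

lemma pear_P_subset: "x \<in> V \<Longrightarrow> set (P x) \<subseteq> set (Q x)"
  by (simp add: pear_sublist set_mono_sublist)

lemma pear_P_internal: "x \<in> V \<Longrightarrow> internal_verts (P x) \<subseteq> internal_verts (Q x)"
  by (simp add: pear_sublist pear_nonempty pear_distinct internal_verts_mono_sublist)

lemma pear_end_or_outside:
  assumes "(y, x) \<in> R" "z \<in> V" "(y, z) \<notin> R\<^sup>+" "v \<in> set (Q x)" "v \<in> set (Q z)"
  shows "v = hd (Q x) \<or> v = last (Q x)"
  using assms pear_internal by (auto simp: internal_verts_def)

text \<open>\<open>P c\<close> separates the descendants of \<open>c\<close> from all other nodes. A
  vertex that \<open>Q z\<close> shares with a non-descendant is not internal to \<open>Q z\<close>,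
  so it is an end and lies on \<open>P\<close>, hence on \<open>Q\<close>, of the parent; this
  repeats up to \<open>c\<close>.\<close>

lemma pear_common_vertex:
  assumes "(c, z) \<in> R\<^sup>+" "u \<in> V" "(c, u) \<notin> R\<^sup>+" "v \<in> set (Q z)" "v \<in> set (Q u)"
  shows "v \<in> set (P c)"
  using assms(1,4)
proof (induction rule: trancl_induct)
  case (base z)
  then show ?case using pear_end_or_outside[of c z u v] assms pear_hd pear_last by blast
next
  case (step w z)
  then have "(w, u) \<notin> R\<^sup>+" using assms(3) by (meson trancl_trans)
  then have "v \<in> set (P w)"
    using pear_end_or_outside[of w z u v] assms step pear_hd pear_last by blast
  then show ?case using step in_V pear_P_subset by blast
qed

text \<open>Reversing both lists of a node keeps them nested and keeps their ends and interiors.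
  Each move below is therefore proved for one orientation only.\<close>

lemma pear_flip:
  assumes "pair_graph G"
  shows "pear G (P(x := rev (P x))) (Q(x := rev (Q x)))"
proof (rule pearI, goal_cases)
  case (1 z)
  then show ?case using pear_vpath vpath_rev[OF assms] by auto
next
  case (4 y z)
  then show ?case using pear_hd pear_last pear_nonempty in_V by (auto simp: hd_rev)
next
  case (5 y z)
  then show ?case using pear_hd pear_last pear_nonempty in_V by (auto simp: last_rev)
next
  case (6 y z w v)
  then show ?case using pear_internal[of y z w v] by (auto split: if_splits)
next
  case (7 y z w v)
  then show ?case using pear_sibling[of y z w v] by (auto split: if_splits)
next
  case (8 y)
  have "{hd ((P(x := rev (P x))) y), last ((P(x := rev (P x))) y)} = {hd (P y), last (P y)}"
    using pear_nonempty[OF 8] by (auto simp: hd_rev last_rev)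
  moreover have "set ((Q(x := rev (Q x))) z) = set (Q z)" for z by simp
  ultimately show ?case using pear_clean[OF 8] by metis
qed (use pear_length pear_sublist in auto)

end

section \<open>Moves that decrease the total length\<close>

definition weight :: "('b \<Rightarrow> 'a list) \<Rightarrow> nat" where
  "weight Q = (\<Sum>x \<in> V. length (Q x))"

text \<open>The chain of contractions may be empty, as it is for the rerouting move. Since only the
  weight of \<open>Q\<close> matters, the property is insensitive to reversals.\<close>

definition improvable :: "'a pair_pre_digraph \<Rightarrow> ('b \<Rightarrow> 'a list) \<Rightarrow> bool" where
  "improvable G Q \<longleftrightarrow>
     (\<exists>G' P' Q'. contract_step\<^sup>*\<^sup>* G G' \<and> pair_graph G' \<and> pear G' P' Q' \<and> weight Q' < weight Q)"

lemma weight_flip: "weight (Q(x := rev (Q x))) = weight Q"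
  unfolding weight_def by (rule sum.cong) auto

lemma improvable_flip: "improvable G (Q(x := rev (Q x))) \<longleftrightarrow> improvable G Q"
  by (simp add: improvable_def weight_flip)

text \<open>Besides \<open>Q x\<close>, only a \<open>Q x'\<close> ending in \<open>a1\<close>,
  \<open>a\<close> can contain both ends of the contracted edge. In these two \<open>a\<close> is
  cut off first, which spares \<open>P x\<close> and \<open>P x'\<close> and loses no vertex after
  merging, because \<open>a1\<close> then becomes \<open>a\<close>.\<close>

lemma ear_contract:
  assumes G: "pair_graph G" and pear: "pear G P Q"
    and yx: "(y, x) \<in> R" and yx': "(y, x') \<in> R" and "x \<noteq> x'"
    and Qx: "Q x = a # a1 # rest" and Px: "sublist (P x) (a1 # rest)"
    and Qx': "a1 \<notin> set (Q x') \<or> (\<exists>pre. Q x' = pre @ [a1, a] \<and> sublist (P x') (pre @ [a1]))"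
  shows "improvable G Q"
proof -
  note xV = in_V[OF yx] in_V[OF yx']
  define f where "f = merge a a1"
  define G' where "G' = contract_edge G a a1"
  define Q0 where "Q0 = Q(x := a1 # rest, x' := if a1 \<in> set (Q x') then butlast (Q x') else Q x')"
  define Q' where "Q' = (\<lambda>z. map f (Q0 z))"
  define P' where "P' = (\<lambda>z. map f (P z))"
  have f_eq: "f v = f w \<Longrightarrow> v = w \<or> v = a \<and> w = a1 \<or> v = a1 \<and> w = a" for v w
    by (auto simp: f_def merge_eq_iff doubleton_eq_iff)
  have fa1: "f a1 = f a" by (simp add: f_def merge_def)
  have dx: "distinct (a # a1 # rest)" using pear_distinct[OF pear xV(2)] Qx by simp
  have arc: "(a, a1) \<in> parcs G"
    using pear_vpath[OF pear xV(2)] by (simp add: vpath_with_proj_iff Qx)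
  have rest: "rest \<noteq> []"
    using sublist_length_le[OF Px] pear_length[OF pear xV(2)] by auto
  have a_Py: "a \<in> set (P y)" using pear_hd[OF pear yx] Qx by simp
  then have a_Qy: "a \<in> set (Q y)" using pear_P_subset[OF pear xV(1)] by blast
  have a1_int: "a1 \<in> internal_verts (Q x)"
    using dx rest by (auto simp: internal_verts_def Qx)
  then have a1_Qx: "a1 \<in> set (Q x)" by (auto simp: internal_verts_def)
  have a1_desc: "(y, z) \<in> R\<^sup>+" if "z \<in> V" "a1 \<in> set (Q z)" for z
    using pear_internal[OF pear yx that(1) _ a1_int that(2)] by blast
  have split: "z = x \<or> z = x' \<or> (x, z) \<in> R\<^sup>+ \<or> (x', z) \<in> R\<^sup>+" if "(y, z) \<in> R\<^sup>+" for z
    using that at_most_two_children[OF yx yx' \<open>x \<noteq> x'\<close>]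
    by (metis converse_tranclE)
  have a_Px: "a \<notin> set (P x)" using set_mono_sublist[OF Px] dx by auto
  have x'_cases: "a1 \<notin> set (Q x') \<or> a1 \<in> set (Q x') \<and> a \<notin> set (P x') \<and>
      sublist (Q0 x') (Q x') \<and> sublist (P x') (Q0 x') \<and> a \<notin> set (Q0 x') \<and> a1 \<in> set (Q0 x') \<and>
      last (Q x') = a \<and> last (Q0 x') = a1 \<and> hd (Q0 x') = hd (Q x') \<and>
      set (Q x') = insert a (set (Q0 x'))"
  proof (cases "a1 \<in> set (Q x')")
    case True
    then obtain pre where pre: "Q x' = pre @ [a1, a]" "sublist (P x') (pre @ [a1])" using Qx'
      by blast
    then have "Q0 x' = pre @ [a1]" using True by (simp add: Q0_def butlast_append)
    moreover have "distinct (pre @ [a1, a])" using pear_distinct[OF pear xV(4)] pre by simp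
    moreover have "sublist (pre @ [a1]) (pre @ [a1, a])"
      using sublist_append_rightI[of "pre @ [a1]" "[a]"] by simp
    ultimately show ?thesis using pre set_mono_sublist[OF pre(2)] by (auto simp: hd_append)
  qed simp
  \<comment> \<open>Such a \<open>z\<close> would lie below \<open>x\<close> or \<open>x'\<close>.
    As \<open>a\<close> is on \<open>Q y\<close> and \<open>a1\<close> on \<open>Q x\<close>,
    separation would put \<open>a\<close> on \<open>P x\<close>, or both \<open>a\<close> and
    \<open>a1\<close> on \<open>P x'\<close>.\<close>
  have both: "\<not> (a \<in> set (Q z) \<and> a1 \<in> set (Q z))" if z: "z \<in> V" "z \<noteq> x" "z \<noteq> x'" for z
  proof
    assume aa: "a \<in> set (Q z) \<and> a1 \<in> set (Q z)"
    then consider "(x, z) \<in> R\<^sup>+" | "(x', z) \<in> R\<^sup>+" using a1_desc split z by blast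
    then show False
    proof cases
      case 1
      then show ?thesis
        using pear_common_vertex[OF pear 1 xV(1) parent_not_descendant[OF yx]] aa a_Qy a_Px by blast
    next
      case 2
      have "a \<in> set (P x')"
        using pear_common_vertex[OF pear 2 xV(1) parent_not_descendant[OF yx']] aa a_Qy by blast
      moreover have "a1 \<in> set (P x')"
        using pear_common_vertex[OF pear 2 xV(2) sibling_not_descendant[OF yx' yx]] aa a1_Qx
          by blast
      ultimately show ?thesis using x'_cases pear_P_subset[OF pear xV(4)] by blast
    qed
  qed
  have bothP: "\<not> (a \<in> set (P z) \<and> a1 \<in> set (P z))" if "z \<in> V" for z
    using both[OF that] a_Px x'_cases pear_P_subset[OF pear that] by blast
  have Q0: "sublist (Q0 z) (Q z) \<and> sublist (P z) (Q0 z) \<and> \<not> {a, a1} \<subseteq> set (Q0 z)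
      \<and> f ` set (Q0 z) = f ` set (Q z) \<and> f (hd (Q0 z)) = f (hd (Q z)) \<and> f (last (Q0 z)) = f (last (Q z))"
    if "z \<in> V" for z
  proof -
    consider (x) "z = x" | (x') "z = x'" "a1 \<in> set (Q x')" | (x'') "z = x'" "a1 \<notin> set (Q x')" | (o) "z \<noteq> x" "z \<noteq> x'"
      by blast
    then show ?thesis
    proof cases
      case x
      then have "Q0 z = a1 # rest" using \<open>x \<noteq> x'\<close> by (simp add: Q0_def)
      moreover have "sublist (a1 # rest) (a # a1 # rest)" using sublist_tl[of "a # a1 # rest"]
        by simp
      ultimately show ?thesis using x Px dx rest by (auto simp: Qx fa1)
    next
      case x'
      then have "f ` set (Q x') = insert (f a1) (f ` set (Q0 x'))" using x'_cases fa1 by auto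
      also have "\<dots> = f ` set (Q0 x')" using x' x'_cases by (simp add: insert_absorb)
      finally have "f ` set (Q x') = f ` set (Q0 x')" .
      moreover have "sublist (Q0 x') (Q x')" "sublist (P x') (Q0 x')" "a \<notin> set (Q0 x')"
        "hd (Q0 x') = hd (Q x')" "last (Q x') = a" "last (Q0 x') = a1" using x' x'_cases by blast+
      ultimately show ?thesis using x' fa1 by simp
    next
      case x''
      then show ?thesis using pear_sublist[OF pear that] by (auto simp: Q0_def)
    next
      case o
      then show ?thesis using both[OF that o] pear_sublist[OF pear that] by (auto simp: Q0_def)
    qed
  qed
  have ne: "P z \<noteq> []" "Q0 z \<noteq> []" if "z \<in> V" for z
    using Q0[OF that] pear_nonempty[OF pear that] sublist_Nil_right by fastforce+
  have hdQ': "hd (Q' z) = f (hd (Q z))" and lastQ': "last (Q' z) = f (last (Q z))"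
    and setQ': "set (Q' z) = f ` set (Q z)" if "z \<in> V" for z
    using Q0[OF that] ne[OF that] by (auto simp: Q'_def hd_map last_map)
  have intQ': "\<exists>v0 \<in> internal_verts (Q z). v = f v0 \<and> f v0 \<noteq> f (hd (Q z)) \<and> f v0 \<noteq> f (last (Q z))"
    if "z \<in> V" "v \<in> internal_verts (Q' z)" for v z
    using that(2) unfolding internal_verts_def hdQ'[OF that(1)] lastQ'[OF that(1)] setQ'[OF that(1)]
      by auto
  have intP': "\<exists>v0 \<in> internal_verts (P z). v = f v0"
    if "z \<in> V" "v \<in> internal_verts (P' z)" for v z
    using that ne by (auto simp: internal_verts_def P'_def hd_map last_map)
  \<comment> \<open>Every path through \<open>a1\<close> belongs to a descendant of
    \<open>y\<close>; if \<open>a1\<close> is also internal to \<open>Q z\<close>, then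
    \<open>x\<close> is below \<open>t\<close>. Together these leave only
    \<open>t = y\<close>.\<close>
  have key: "t = y" if "(t, z) \<in> R" "a1 \<in> internal_verts (Q z)" for t z
  proof -
    have "z \<in> V" using that(1) in_V by blast
    have "(t, x) \<in> R\<^sup>+" using pear_internal[OF pear that(1) xV(2) _ that(2)] a1_Qx by blast
    then have 1: "y = t \<or> (t, y) \<in> R\<^sup>+" using parent_of_descendant yx by blast
    have "a1 \<in> set (Q z)" using that by (simp add: internal_verts_def)
    then have "(y, z) \<in> R\<^sup>+" using a1_desc \<open>z \<in> V\<close> by blast
    then show ?thesis using 1 parent_of_descendant[OF that(1)] descendant_antisym by blast
  qed
  have key2: "(t, y) \<in> R\<^sup>+" if "(t, z) \<in> R" "a \<in> internal_verts (Q z)" for t z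
    using pear_internal[OF pear that(1) xV(1) _ that(2)] a_Qy by blast
  have "pear G' P' Q'"
  proof (rule pearI, goal_cases)
    case (1 z)
    then show ?case
      using vpath_map_merge[OF G, of "Q0 z" a a1] vpath_sublist[OF pear_vpath[OF pear 1]] Q0[OF 1] ne[OF 1]
      by (simp add: Q'_def G'_def f_def)
  next
    case (2 z)
    then show ?case using pear_length[OF pear] by (simp add: P'_def)
  next
    case (3 z)
    then show ?case using Q0 by (simp add: P'_def Q'_def map_mono_sublist)
  next
    case (4 t z)
    then show ?case using pear_hd[OF pear 4] hdQ' in_V
      by (simp add: P'_def)
  next
    case (5 t z)
    then show ?case using pear_last[OF pear 5] lastQ' in_V
      by (simp add: P'_def)
  next
    case (6 t z w v)
    have tz: "t \<in> V" "z \<in> V" using 6(1) in_V by blast+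
    obtain v0 where v0: "v0 \<in> internal_verts (Q z)" "v = f v0" "f v0 \<noteq> f (hd (Q z))" "f v0 \<noteq> f (last (Q z))"
      using intQ' 6 tz by blast
    obtain w0 where w0: "w0 \<in> set (Q w)" "v = f w0" using 6 setQ' by auto
    \<comment> \<open>Only the merged vertex can be a new intersection. If \<open>v0\<close> is
      \<open>a\<close>, then \<open>t\<close> is above \<open>y\<close> and \<open>y\<close> above
      \<open>w\<close>, so \<open>w\<close> is below \<open>t\<close>. If \<open>v0\<close> is
      \<open>a1\<close>, then \<open>a\<close> is an end of \<open>Q z\<close>, so the merged vertex
      is not internal.\<close>
    have "v0 \<noteq> w0" using pear_internal[OF pear 6(1-3) v0(1)] w0 by blast
    then consider "v0 = a" "w0 = a1" | "v0 = a1" "w0 = a" using f_eq v0 w0 by metis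
    then show ?case
    proof cases
      case 1
      then have "(t, y) \<in> R\<^sup>+" using key2 6(1) v0 by blast
      moreover have "(y, w) \<in> R\<^sup>+" using a1_desc 6 w0 1 by blast
      ultimately show ?thesis using 6(3) by (meson trancl_trans)
    next
      case 2
      then have "z = x \<or> z = x'"
        using key 6(1) v0 at_most_two_children[OF yx yx' \<open>x \<noteq> x'\<close>] by blast
      moreover have "a1 \<in> set (Q z)" using v0 2 by (simp add: internal_verts_def)
      ultimately have "a = hd (Q z) \<or> a = last (Q z)" using x'_cases by (auto simp: Qx)
      then show ?thesis using v0 2 fa1 by auto
    qed
  next
    case (7 t z w v)
    have tz: "t \<in> V" "z \<in> V" "w \<in> V" using 7(1,2) in_V by blast+
    obtain v0 where v0: "v0 \<in> internal_verts (P z)" "v = f v0" using intP' 7 tz by blast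
    have v0Q: "v0 \<in> internal_verts (Q z)" using v0 pear_P_internal[OF pear tz(2)] by blast
    obtain w0 where w0: "w0 \<in> set (Q w)" "v = f w0" using 7 tz setQ' by auto
    have "v0 \<noteq> w0" using pear_sibling[OF pear 7(1-3) v0(1)] w0 by blast
    then consider "v0 = a" "w0 = a1" | "v0 = a1" "w0 = a" using f_eq v0 w0 by metis
    then show ?case
    proof cases
      case 1
      then have "(t, y) \<in> R\<^sup>+" using key2 7(1) v0Q by blast
      moreover have "(y, w) \<in> R\<^sup>+" using a1_desc tz w0 1 by blast
      ultimately show ?thesis using parent_of_descendant[OF 7(2)] descendant_antisym by blast
    next
      case 2
      then have "t = y" using key 7(1) v0Q by blast
      then consider "z = x" | "z = x'"
        using 7(1) at_most_two_children[OF yx yx' \<open>x \<noteq> x'\<close>] by blast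
      then show ?thesis
      proof cases
        case 1
        have "internal_verts (P x) \<subseteq> internal_verts (a1 # rest)"
          using internal_verts_mono_sublist[OF _ Px ne(1)[OF xV(2)]] dx by simp
        then show ?thesis using v0 2 1 by (auto simp: internal_verts_def)
      next
        case 2
        then show ?thesis using pear_sibling[OF pear yx' yx] \<open>x \<noteq> x'\<close> v0 \<open>v0 = a1\<close> a1_Qx by metis
      qed
    qed
  next
    case (8 t)
    obtain e where e: "e \<in> {hd (P t), last (P t)}" "\<And>k. (t, k) \<in> R \<Longrightarrow> e \<notin> set (Q k)"
      using pear_clean[OF pear 8] by blast
    have ePt: "e \<in> set (P t)" using e(1) ne[OF 8] by auto
    have "f e \<notin> set (Q' k)" if tk: "(t, k) \<in> R" for k
    proof
      have k: "k \<in> V" using tk in_V by blast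
      assume "f e \<in> set (Q' k)"
      then obtain w0 where w0: "w0 \<in> set (Q k)" "f e = f w0" using setQ'[OF k] by auto
      then have "e \<noteq> w0" using e(2)[OF tk] by blast
      then consider "e = a" "w0 = a1" | "e = a1" "w0 = a" using f_eq w0 by metis
      then show False
      proof cases
        case 1
        \<comment> \<open>\<open>a\<close> lies on \<open>Q x\<close>, so it is not the free end of
          \<open>P y\<close>. Then \<open>t\<close> is below \<open>y\<close>, and separation at
          \<open>t\<close> puts \<open>a1\<close> on \<open>P t\<close> together with
          \<open>a\<close>.\<close>
        have "t \<noteq> y" using e(2)[of x] yx 1 Qx by auto
        then have yt: "(y, t) \<in> R\<^sup>+" using a1_desc[OF k] w0 1 parent_of_descendant[OF tk] by blast
        then have "(t, x) \<notin> R\<^sup>+"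
          using parent_of_descendant[OF yx] descendant_antisym \<open>t \<noteq> y\<close> by blast
        then have "a1 \<in> set (P t)"
          using pear_common_vertex[OF pear r_into_trancl[OF tk] xV(2)] w0 1 a1_Qx by blast
        then show False using bothP[OF 8] ePt 1 by blast
      next
        case 2
        then have "(y, t) \<in> R\<^sup>+" using a1_desc[OF 8] ePt pear_P_subset[OF pear 8] by blast
        then have "(t, y) \<notin> R\<^sup>+" using descendant_antisym by blast
        then have "a \<in> set (P t)"
          using pear_common_vertex[OF pear r_into_trancl[OF tk] xV(1)] w0 2 a_Qy by blast
        then show False using bothP[OF 8] ePt 2 by blast
      qed
    qed
    moreover have "f e \<in> {hd (P' t), last (P' t)}"
      using e(1) ne[OF 8] by (auto simp: P'_def hd_map last_map)
    ultimately show ?case by blast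
  qed
  moreover have "weight Q' < weight Q"
    unfolding weight_def
  proof (rule sum_strict_mono_ex1[OF finite_V])
    show "\<forall>z \<in> V. length (Q' z) \<le> length (Q z)"
      using Q0 sublist_length_le by (fastforce simp: Q'_def)
    show "\<exists>z \<in> V. length (Q' z) < length (Q z)"
      using xV(2) \<open>x \<noteq> x'\<close> by (intro bexI[of _ x]) (auto simp: Q'_def Q0_def Qx)
  qed
  moreover have "contract_step\<^sup>*\<^sup>* G G'"
    using arc by (intro r_into_rtranclp) (auto simp: contract_step_def G'_def)
  moreover have "pair_graph G'" unfolding G'_def by (rule pair_graph_contract_edge[OF G])
  ultimately show ?thesis unfolding improvable_def by blast
qed


text \<open>The edge between \<open>a1\<close> and \<open>a\<close> is borrowed from
  \<open>Q x\<close>. The new ear ends on \<open>P y\<close> because \<open>a\<close> does, and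
  \<open>hd (Q x') \<noteq> a\<close> keeps it a path. The weight may stay equal, but
  \<open>Q x'\<close> now ends in \<open>a1\<close>, \<open>a\<close>, as
  \<open>ear_contract\<close> demands.\<close>

lemma ear_shortcut:
  assumes G: "pair_graph G" and pear: "pear G P Q"
    and yx: "(y, x) \<in> R" and yx': "(y, x') \<in> R" and "x \<noteq> x'"
    and Qx: "Q x = a # a1 # rest" and Px: "sublist (P x) (a1 # rest)"
    and Qx': "Q x' = pre @ a1 # suf" and Px': "sublist (P x') (pre @ [a1])" and hd: "hd (Q x') \<noteq> a"
  shows "pear G P (Q(x' := pre @ [a1, a]))" "weight (Q(x' := pre @ [a1, a])) \<le> weight Q"
proof -
  interpret pair_graph G by fact
  note xV = in_V[OF yx] in_V[OF yx']
  let ?Q = "Q(x' := pre @ [a1, a])"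
  have dx: "distinct (a # a1 # rest)" using pear_distinct[OF pear xV(2)] Qx by simp
  have dx': "distinct (pre @ a1 # suf)" using pear_distinct[OF pear xV(4)] Qx' by simp
  have rest: "rest \<noteq> []"
    using sublist_length_le[OF Px] pear_length[OF pear xV(2)] by auto
  have arc: "(a1, a) \<in> parcs G" "a \<in> pverts G"
    using pear_vpath[OF pear xV(2)] by (auto simp: vpath_with_proj_iff Qx intro: arcs_symmetric)
  have a_Py: "a \<in> set (P y)" using pear_hd[OF pear yx] Qx by simp
  then have a_Qy: "a \<in> set (Q y)" using pear_P_subset[OF pear xV(1)] by blast
  have "a1 \<in> internal_verts (Q x)"
    using dx rest by (auto simp: internal_verts_def Qx)
  then have a1: "a1 \<notin> set (P y)"
    using pear_internal[OF pear yx xV(1) not_descendant_self] pear_P_subset[OF pear xV(1)] by blast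
  have "last (Q x') \<in> set (P y)" "hd (Q x') \<in> set (P y)"
    using pear_last[OF pear yx'] pear_hd[OF pear yx'] by auto
  \<comment> \<open>\<open>a1\<close> is off \<open>P y\<close> while both ends of
    \<open>Q x'\<close> are on it, so something follows \<open>a1\<close> that the new edge can
    replace.\<close>
  then have suf: "suf \<noteq> []" and pre: "pre \<noteq> []" using a1 by (auto simp: Qx')
  have a_end: "a = hd (Q x') \<or> a = last (Q x')" if "a \<in> set (Q x')"
    using pear_end_or_outside[OF pear yx' xV(1) not_descendant_self that a_Qy] .
  have a_pre: "a \<notin> set pre"
  proof
    assume "a \<in> set pre"
    then have "a = last suf" using a_end hd suf by (auto simp: Qx')
    then show False using \<open>a \<in> set pre\<close> suf dx' by auto
  qed
  have hd': "hd (?Q x') = hd (Q x')" using pre by (simp add: Qx')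
  have sub: "set (?Q z) \<subseteq> insert a (set (Q z))" for z by (auto simp: Qx')
  \<comment> \<open>No interior grows, so a new conflict can only come from \<open>a\<close> lying
    on the new \<open>Q x'\<close>.\<close>
  have int: "internal_verts (?Q z) \<subseteq> internal_verts (Q z)" for z
    using dx' pre suf a_pre by (auto simp: internal_verts_def Qx')
  show "pear G P ?Q"
  proof (rule pearI, goal_cases)
    case (1 z)
    have "vpath (pre @ [a1, a]) (with_proj G)"
      using pear_vpath[OF pear xV(4)] arc a_pre dx
      by (auto simp: vpath_with_proj_iff Qx' successively_append_iff)
    then show ?case using pear_vpath[OF pear 1] by simp
  next
    case (3 z)
    have "sublist (pre @ [a1]) (pre @ [a1, a])"
      using sublist_append_rightI[of "pre @ [a1]" "[a]"] by simp
    then show ?case using pear_sublist[OF pear 3] Px' by (auto intro: sublist_order.order.trans)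
  next
    case (4 t z)
    then show ?case using pear_hd[OF pear 4] hd' by auto
  next
    case (5 t z)
    then show ?case using pear_last[OF pear 5] a_Py parent_unique[OF yx'] by auto
  next
    case (6 t z w v)
    have v: "v \<in> internal_verts (Q z)" using 6(4) int by blast
    show ?case
    proof (cases "w = x' \<and> v = a")
      case True
      have "(t, y) \<in> R\<^sup>+" using pear_internal[OF pear 6(1) xV(1) _ v] a_Qy True by blast
      then show ?thesis using 6(3) True yx' by (meson trancl_into_trancl)
    next
      case False
      then have "v \<in> set (Q w)" using 6(5) sub by (auto simp: Qx' split: if_splits)
      then show ?thesis using pear_internal[OF pear 6(1-3) v] by blast
    qed
  next
    case (7 t z w v)
    show ?case
    proof (cases "w = x' \<and> v = a")
      case True
      then have "t = y" using 7(2) yx' parent_unique by blast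
      then show ?thesis
        using pear_internal[OF pear 7(1) xV(1)] not_descendant_self 7(4) True a_Qy
          pear_P_internal[OF pear in_V(2)[OF 7(1)]] by blast
    next
      case False
      then have "v \<in> set (Q w)" using 7(5) by (auto simp: Qx' split: if_splits)
      then show ?thesis using pear_sibling[OF pear 7(1-4)] by blast
    qed
  next
    case (8 t)
    obtain e where e: "e \<in> {hd (P t), last (P t)}" "\<And>k. (t, k) \<in> R \<Longrightarrow> e \<notin> set (Q k)"
      using pear_clean[OF pear 8] by blast
    have "e \<notin> set (?Q k)" if "(t, k) \<in> R" for k
    proof (cases "k = x'")
      case True
      then have "t = y" using that yx' parent_unique by blast
      \<comment> \<open>The free end of \<open>P y\<close> avoids \<open>Q x\<close>, whereas
        \<open>a\<close> lies on it.\<close>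
      then have "e \<noteq> a" using e(2)[of x] yx by (auto simp: Qx)
      then show ?thesis using e(2)[OF that] sub by blast
    qed (use e(2)[OF that] in simp)
    then show ?case using e(1) by blast
  qed (use pear_length[OF pear] in auto)
  show "weight ?Q \<le> weight Q"
    unfolding weight_def using suf by (intro sum_mono) (auto simp: Qx' Suc_le_eq)
qed

text \<open>If \<open>a1\<close> lies on both ears, the shortcut comes first at no cost; the
  contraction then yields the strict decrease.\<close>

lemma ear_end_improvable:
  assumes G: "pair_graph G" and pear: "pear G P Q"
    and yx: "(y, x) \<in> R" and yx': "(y, x') \<in> R" and "x \<noteq> x'"
    and Qx: "Q x = a # a1 # rest" and Px: "sublist (P x) (a1 # rest)"
    and Qx': "a1 \<notin> set (Q x') \<or>
      (\<exists>pre suf. Q x' = pre @ a1 # suf \<and> sublist (P x') (pre @ [a1]) \<and> hd (Q x') \<noteq> a)"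
  shows "improvable G Q"
proof (cases "a1 \<in> set (Q x')")
  case False
  then show ?thesis using ear_contract[OF G pear yx yx' \<open>x \<noteq> x'\<close> Qx Px] by blast
next
  case True
  then obtain pre suf where s: "Q x' = pre @ a1 # suf" "sublist (P x') (pre @ [a1])" "hd (Q x') \<noteq> a"
    using Qx' by blast
  note shortcut = ear_shortcut[OF G pear yx yx' \<open>x \<noteq> x'\<close> Qx Px s]
  have "improvable G (Q(x' := pre @ [a1, a]))"
    using ear_contract[OF G shortcut(1) yx yx' \<open>x \<noteq> x'\<close>, of a a1 rest] Qx Px s(2) \<open>x \<noteq> x'\<close> by simp
  then show ?thesis using shortcut(2) unfolding improvable_def by (meson less_le_trans)
qed


text \<open>\<open>G\<close> itself is kept. The vertices \<open>A @ [u]\<close> inserted into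
  \<open>P y\<close> are internal to \<open>Q x\<close>, so they were off \<open>Q y\<close> and
  occur only on paths of descendants of \<open>y\<close>. The order of \<open>a\<close> and
  \<open>b\<close> on \<open>P y\<close> is fixed here.\<close>

lemma ear_reroute_oriented:
  assumes G: "pair_graph G" and pear: "pear G P Q"
    and yx: "(y, x) \<in> R" and yx': "(y, x') \<in> R" and "x \<noteq> x'"
    and Qx: "Q x = a # A @ u # D" and Px: "sublist (P x) (u # D)"
    and Qx': "Q x' = C @ [u, b]" and Px': "sublist (P x') (C @ [u])"
    and hd: "hd (Q x') = a" and last: "last (Q x) = b"
    and Py: "P y = S1 @ a # S2 @ b # S3"
  shows "improvable G Q"
proof -
  interpret pair_graph G by fact
  note xV = in_V[OF yx] in_V[OF yx']
  have dx: "distinct (a # A @ u # D)" using pear_distinct[OF pear xV(2)] Qx by simp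
  have dx': "distinct (C @ [u, b])" using pear_distinct[OF pear xV(4)] Qx' by simp
  have neq: "y \<noteq> x" "y \<noteq> x'" using not_descendant_self yx yx' by blast+
  have "D \<noteq> []"
    using sublist_length_le[OF Px] pear_length[OF pear xV(2)] by auto
  then have D: "last D = b" "b \<in> set D" using last by (auto simp: Qx)
  have "C \<noteq> []"
    using sublist_length_le[OF Px'] pear_length[OF pear xV(4)] by auto
  then have C: "hd C = a" using hd by (simp add: Qx')
  let ?W = "set (a # A @ [u])"
  have intPx': "internal_verts (P x') \<inter> ?W = {}"
    using pear_sibling[OF pear yx' yx] \<open>x \<noteq> x'\<close> by (auto simp: Qx)
  \<comment> \<open>\<open>Q x'\<close> is cut back around \<open>P x'\<close> to its nearest
    contacts with the new segment. Contacts exist on both sides, because \<open>C @ [u]\<close>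
    starts at \<open>a\<close> and ends at \<open>u\<close>.\<close>
  obtain l where l: "sublist l (C @ [u])" "sublist (P x') l" "hd l \<in> ?W" "last l \<in> ?W"
      "internal_verts l \<inter> ?W = {}"
    using shrink_to_ends_in[OF Px' _ _ _ intPx'] pear_nonempty[OF pear xV(4)] C \<open>C \<noteq> []\<close>
    by auto
  obtain X Y where Qy: "Q y = X @ P y @ Y" using pear_sublist[OF pear xV(1)]
    by (auto simp: sublist_def)
  define Py' where "Py' = S1 @ a # A @ u # b # S3"
  define Qy' where "Qy' = X @ Py' @ Y"
  define P' where "P' = P(y := Py')"
  define Q' where "Q' = Q(y := Qy', x := u # D, x' := l)"
  have Q'_simps: "Q' y = Qy'" "Q' x = u # D" "Q' x' = l" "z \<notin> {y, x, x'} \<Longrightarrow> Q' z = Q z" for z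
    using neq \<open>x \<noteq> x'\<close> by (auto simp: Q'_def)
  have P'_simps: "P' y = Py'" "z \<noteq> y \<Longrightarrow> P' z = P z" for z
    by (auto simp: P'_def)
  have Au: "set (A @ [u]) \<subseteq> internal_verts (Q x)"
    using dx D by (auto simp: internal_verts_def Qx \<open>D \<noteq> []\<close>)
  then have AuQy: "set (A @ [u]) \<inter> set (Q y) = {}"
    using pear_internal[OF pear yx xV(1) not_descendant_self] by blast
  have setP': "set Py' \<subseteq> set (P y) \<union> set (A @ [u])" by (auto simp: Py'_def Py)
  have setQy': "set Qy' \<subseteq> set (Q y) \<union> set (A @ [u])" by (auto simp: Qy'_def Py'_def Qy Py)
  have W: "?W \<subseteq> set Py'" "b \<in> set Py'" by (auto simp: Py'_def)
  have hdP': "hd (P' t) = hd (P t)" and lastP': "last (P' t) = last (P t)" for t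
    by (auto simp: P'_def Py'_def Py hd_append)
  have hdQ': "hd (Q' y) = hd (Q y)" and lastQ': "last (Q' y) = last (Q y)"
    unfolding Q'_simps by (auto simp: Qy'_def Py'_def Qy Py hd_append)
  have lQ: "set l \<subseteq> set (Q x') - {b}" using set_mono_sublist[OF l(1)] dx' by (auto simp: Qx')
  have setQ': "set (Q' z) \<subseteq> set (Q z)" if "z \<noteq> y" for z
    using lQ that by (cases "z = x"; cases "z = x'") (auto simp: Q'_simps Qx Q'_def)
  have intx: "internal_verts (Q' x) \<subseteq> internal_verts (Q x)"
    using dx \<open>D \<noteq> []\<close> by (auto simp: internal_verts_def Q'_simps Qx)
  have intx': "internal_verts (Q' x') \<subseteq> internal_verts (Q x')"
    using lQ l(5) \<open>C \<noteq> []\<close> by (auto simp: internal_verts_def Q'_simps hd) (auto simp: Qx')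
  have vpy: "vpath Qy' (with_proj G)"
  proof -
    have 1: "vpath (X @ S1 @ a # S2 @ b # S3 @ Y) (with_proj G)"
      using pear_vpath[OF pear xV(1)] by (simp add: Qy Py)
    have 2: "vpath (a # A @ u # D) (with_proj G)" using pear_vpath[OF pear xV(2)] by (simp add: Qx)
    have 3: "vpath (C @ [u, b]) (with_proj G)" using pear_vpath[OF pear xV(4)] by (simp add: Qx')
    have "distinct Qy'" using 1 2 AuQy by (auto simp: vpath_with_proj_iff Qy'_def Py'_def Qy Py)
    moreover have "set Qy' \<subseteq> pverts G" using 1 2 by (auto simp: vpath_with_proj_iff Qy'_def Py'_def)
    moreover have "successively (\<lambda>u v. (u, v) \<in> parcs G) Qy'"
    proof -
      let ?s = "successively (\<lambda>u v. (u, v) \<in> parcs G)"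
      have "?s ((X @ S1) @ a # S2 @ b # S3 @ Y)" "?s ((a # A @ [u]) @ D)" "?s (C @ [u, b])"
        using 1 2 3 by (auto simp: vpath_with_proj_iff)
      then have s: "?s (X @ S1)" "X @ S1 \<noteq> [] \<Longrightarrow> (last (X @ S1), a) \<in> parcs G" "?s (b # S3 @ Y)" "?s (a # A @ [u])"
        "(u, b) \<in> parcs G"
        unfolding successively_append_iff successively_Cons
          by (auto simp: successively_append_iff successively_Cons)
      then have "?s ((X @ S1) @ (a # A @ [u]) @ b # S3 @ Y)"
        by (subst successively_append_iff, subst successively_append_iff) auto
      then show ?thesis by (simp add: Qy'_def Py'_def)
    qed
    ultimately show ?thesis by (simp add: vpath_with_proj_iff Qy'_def Py'_def)
  qed
  \<comment> \<open>The only vertices gained anywhere are those of \<open>A @ [u]\<close>, and only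
    the path of \<open>y\<close> gains them.\<close>
  have int_new: "v \<in> internal_verts (Q z) \<or> z = y \<and> v \<in> internal_verts (Q x)"
    if "v \<in> internal_verts (Q' z)" for v z
  proof (cases "z = y")
    case True
    then have "v \<in> set (Q y) \<or> v \<in> internal_verts (Q x)" "v \<noteq> hd (Q y)" "v \<noteq> last (Q y)"
      using that setQy' Au hdQ' lastQ' by (auto simp: internal_verts_def Q'_simps)
    then show ?thesis using True by (auto simp: internal_verts_def)
  next
    case False
    then show ?thesis using that intx intx' Q'_simps(4)[of z]
      by (cases "z = x"; cases "z = x'") auto
  qed
  have set_new: "v \<in> set (Q z) \<or> z = y \<and> v \<in> set (A @ [u])" if "v \<in> set (Q' z)" for v z
    using that setQ'[of z] setQy' by (cases "z = y") (auto simp: Q'_simps)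
  have outside: False if "v \<in> internal_verts (Q x)" "v \<in> set (Q w)" "w \<in> V" "(y, w) \<notin> R\<^sup>+" for v w
    using pear_internal[OF pear yx that(3,4,1,2)] .
  have children: "z = x \<or> z = x'" if "(y, z) \<in> R" for z
    using at_most_two_children[OF yx yx' \<open>x \<noteq> x'\<close> that] .
  have "pear G P' Q'"
  proof (rule pearI, goal_cases)
    case (1 z)
    have "vpath l (with_proj G)"
      using pear_vpath[OF pear xV(4)] l(1,2) pear_nonempty[OF pear xV(4)]
        sublist_append_rightI[of "C @ [u]" "[b]"]
      by (auto simp: Qx' intro!: vpath_sublist[of "C @ [u, b]"] intro: sublist_order.order.trans)
    moreover have "vpath (u # D) (with_proj G)"
      using pear_vpath[OF pear xV(2)] sublist_append_leftI[of "u # D" "a # A"]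
      by (auto simp: Qx intro!: vpath_sublist[of "a # A @ u # D"])
    ultimately show ?case using vpy pear_vpath[OF pear 1] by (auto simp: Q'_def)
  next
    case (2 z)
    then show ?case using pear_length[OF pear 2] by (auto simp: P'_def Py'_def)
  next
    case (3 z)
    then show ?case using pear_sublist[OF pear 3] Px l(2) neq by (auto simp: P'_def Q'_def Qy'_def)
  next
    case (4 t z)
    show ?case
    proof (cases "t = y")
      case True
      then show ?thesis using children[of z] 4 l(3) W by (auto simp: Q'_simps P'_simps)
    next
      case False
      then have "z \<noteq> x" "z \<noteq> x'" using 4 yx yx' parent_unique by blast+
      then show ?thesis using pear_hd[OF pear 4] False hdQ' Q'_simps(4)[of z]
        by (cases "z = y") (auto simp: P'_simps)
    qed
  next
    case (5 t z)
    show ?case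
    proof (cases "t = y")
      case True
      then show ?thesis using children[of z] 5 l(4) W D by (auto simp: Q'_simps P'_simps)
    next
      case False
      then have "z \<noteq> x" "z \<noteq> x'" using 5 yx yx' parent_unique by blast+
      then show ?thesis using pear_last[OF pear 5] False lastQ' Q'_simps(4)[of z]
        by (cases "z = y") (auto simp: P'_simps)
    qed
  next
    case (6 t z w v)
    show ?case
    proof (cases "v \<in> internal_verts (Q z)")
      case True
      then have "v \<notin> set (Q w)" using pear_internal[OF pear 6(1-3)] by blast
      then have w: "w = y" "v \<in> set (A @ [u])" using set_new 6(5) by blast+
      then have "v \<in> set (Q x)" by (auto simp: Qx)
      then have "(t, x) \<in> R\<^sup>+" using pear_internal[OF pear 6(1) xV(2) _ True] by blast
      \<comment> \<open>\<open>x\<close> is below \<open>t\<close> but \<open>y\<close> is not, so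
        \<open>t\<close> is \<open>y\<close> and \<open>z\<close> is one of the two ears. However,
        the new \<open>Q x\<close> meets \<open>A @ [u]\<close> only in its head \<open>u\<close>,
        and \<open>l\<close> has no internal vertex on the new segment.\<close>
      then have "t = y" using parent_of_descendant[OF yx] 6(3) w by blast
      then consider "z = x" | "z = x'" using children 6(1) by blast
      then show ?thesis
      proof cases
        case 1
        then show ?thesis using 6(4) w(2) dx by (auto simp: Q'_simps internal_verts_def)
      next
        case 2
        then show ?thesis using 6(4) w(2) l(5) by (auto simp: Q'_simps)
      qed
    next
      case False
      then have z: "z = y" "v \<in> internal_verts (Q x)" using int_new 6(4) by blast+
      then have "w \<noteq> y" using 6(1,3) by blast
      moreover have "(y, w) \<notin> R\<^sup>+" using 6(1,3) z by (meson trancl_into_trancl2)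
      ultimately show ?thesis using outside[OF z(2)] set_new 6(2,5) by blast
    qed
  next
    case (7 t z w v)
    have zw: "z \<in> V" "w \<in> V" using 7(1,2) in_V by blast+
    have sib: "(z, w) \<notin> R\<^sup>+" "(w, z) \<notin> R\<^sup>+" using sibling_not_descendant 7(1,2) by blast+
    have *: "v \<in> internal_verts (P z) \<or> z = y \<and> v \<in> internal_verts (Q x)"
      using 7(4) setP' Au unfolding internal_verts_def hdP' lastP'
        by (cases "z = y") (auto simp: P'_simps)
    show ?case
    proof (cases "v \<in> internal_verts (P z)")
      case True
      then have "v \<notin> set (Q w)" using pear_sibling[OF pear 7(1-3)] by blast
      then have w: "w = y" "v \<in> set (A @ [u])" using set_new 7(5) by blast+
      have "v \<in> set (Q z)" using True pear_P_internal[OF pear zw(1)]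
        by (auto simp: internal_verts_def)
      then show ?thesis using outside[of v z] w Au zw sib by blast
    next
      case False
      then have z: "z = y" "v \<in> internal_verts (Q x)" using * by blast+
      then show ?thesis using outside[OF z(2)] set_new[OF 7(5)] 7(3) zw sib by blast
    qed
  next
    case (8 t)
    obtain e where e: "e \<in> {hd (P t), last (P t)}" "\<And>k. (t, k) \<in> R \<Longrightarrow> e \<notin> set (Q k)"
      using pear_clean[OF pear 8] by blast
    have "e \<in> set (Q t)" using e(1) pear_nonempty[OF pear 8] pear_P_subset[OF pear 8] by auto
    \<comment> \<open>If \<open>e\<close> were newly hit, then \<open>k\<close> would be
      \<open>y\<close> and \<open>e\<close> an internal vertex of \<open>Q x\<close> lying on
      \<open>Q t\<close>, with \<open>t\<close> the parent of \<open>y\<close>; such vertices occur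
      only below \<open>y\<close>.\<close>
    then have "e \<notin> set (Q' k)" if "(t, k) \<in> R" for k
      using set_new[of e k] e(2)[OF that] outside[of e t] 8 parent_not_descendant that Au by blast
    then show ?case using e(1) hdP' lastP' by auto
  qed
  \<comment> \<open>The path of \<open>y\<close> gains at most \<open>length A + 1\<close> vertices,
    that of \<open>x\<close> loses exactly as many, and that of \<open>x'\<close> loses at least
    \<open>b\<close>.\<close>
  moreover have "weight Q' < weight Q"
  proof -
    have sub: "{y, x, x'} \<subseteq> V" using xV by auto
    have w: "weight F = length (F y) + length (F x) + length (F x') + (\<Sum>z \<in> V - {y, x, x'}. length (F z))"
      for F :: "'b \<Rightarrow> 'a list"
      unfolding weight_def
        using neq \<open>x \<noteq> x'\<close> sum.subset_diff[OF sub finite_V, of "\<lambda>z. length (F z)"] by simp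
    have "(\<Sum>z \<in> V - {y, x, x'}. length (Q' z)) = (\<Sum>z \<in> V - {y, x, x'}. length (Q z))"
      by (rule sum.cong) (auto simp: Q'_simps)
    moreover have "length l \<le> length C + 1" using sublist_length_le[OF l(1)] by simp
    ultimately show ?thesis
      unfolding w[of Q'] w[of Q] Q'_simps by (simp add: Qx Qx' Qy Py Qy'_def Py'_def)
  qed
  ultimately show ?thesis unfolding improvable_def using G by blast
qed

text \<open>\<open>a\<close> and \<open>b\<close> are distinct, being the two ends of
  \<open>Q x\<close>. If they occur on \<open>P y\<close> in the other order, \<open>P y\<close> and
  \<open>Q y\<close> are reversed.\<close>

lemma ear_reroute:
  assumes G: "pair_graph G" and pear: "pear G P Q"
    and yx: "(y, x) \<in> R" and yx': "(y, x') \<in> R" and "x \<noteq> x'"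
    and Qx: "Q x = a # A @ u # D" and Px: "sublist (P x) (u # D)"
    and Qx': "Q x' = C @ [u, b]" and Px': "sublist (P x') (C @ [u])"
    and hd: "hd (Q x') = a" and last: "last (Q x) = b"
  shows "improvable G Q"
proof -
  have "y \<noteq> x" "y \<noteq> x'" using not_descendant_self yx yx' by blast+
  have "a \<in> set (P y)" "b \<in> set (P y)"
    using pear_hd[OF pear yx'] pear_last[OF pear yx] hd last by auto
  moreover have "a \<noteq> b"
    using pear_distinct[OF pear in_V(2)[OF yx]] last by (cases D rule: rev_cases) (auto simp: Qx)
  ultimately have "\<exists>S1 S2 S3. P y = S1 @ a # S2 @ b # S3 \<or> P y = S1 @ b # S2 @ a # S3"
    using split_list_two by metis
  then consider S1 S2 S3 where "P y = S1 @ a # S2 @ b # S3" | S1 S2 S3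
    where "P y = S1 @ b # S2 @ a # S3"
    by blast
  then show ?thesis
  proof cases
    case 1
    then show ?thesis using ear_reroute_oriented[OF assms] by blast
  next
    case 2
    have "rev (P y) = rev S3 @ a # rev S2 @ b # rev S1" using 2 by simp
    then have "improvable G (Q(y := rev (Q y)))"
      using ear_reroute_oriented[OF G pear_flip[OF pear G, of y] yx yx' \<open>x \<noteq> x'\<close>, of a A u D C b "rev S3" "rev S2" "rev S1"]
        assms \<open>y \<noteq> x\<close> \<open>y \<noteq> x'\<close> by simp
    then show ?thesis by (simp add: improvable_flip)
  qed
qed


text \<open>If \<open>Q x'\<close> starts at \<open>a\<close>, the shortcut at \<open>a1\<close> is
  blocked, and the moves are tried from the other end of \<open>Q x'\<close> with the roles of the
  two ears exchanged. They apply unless \<open>Q x\<close> also ends in \<open>b\<close> and meets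
  \<open>u\<close> before \<open>P x\<close>, which is the situation for rerouting.\<close>

lemma common_ear_end_improvable:
  assumes G: "pair_graph G" and pear: "pear G P Q"
    and yx: "(y, x) \<in> R" and yx': "(y, x') \<in> R" and "x \<noteq> x'"
    and Qx: "Q x = a # a1 # rest" and Px: "sublist (P x) (a1 # rest)"
    and Qx': "Q x' = pre @ a1 # suf" and Px': "sublist (P x') (pre @ [a1])"
  shows "improvable G Q"
proof (cases "hd (Q x') = a")
  case False
  then show ?thesis using ear_end_improvable[OF G pear yx yx' \<open>x \<noteq> x'\<close> Qx Px] Qx' Px' by blast
next
  case hd: True
  note xV = in_V[OF yx] in_V[OF yx']
  have "rest \<noteq> []"
    using sublist_length_le[OF Px] pear_length[OF pear xV(2)] by auto
  then have "a1 \<in> internal_verts (Q x)"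
    using pear_distinct[OF pear xV(2)] by (auto simp: internal_verts_def Qx)
  then have "a1 \<notin> set (P y)"
    using pear_internal[OF pear yx xV(1) not_descendant_self] pear_P_subset[OF pear xV(1)] by blast
  then have "suf \<noteq> []" using pear_last[OF pear yx'] by (auto simp: Qx')
  then obtain suf' b where suf: "suf = suf' @ [b]" by (metis append_butlast_last_id)
  \<comment> \<open>\<open>u\<close> is the vertex before the last one, \<open>b\<close>; it is
    \<open>a1\<close> itself when \<open>suf'\<close> is empty.\<close>
  obtain C u where Cu: "C @ [u] = pre @ a1 # suf'"
    by (metis append_butlast_last_id snoc_eq_iff_butlast append_is_Nil_conv list.distinct(1))
  have Qx'C: "Q x' = C @ [u, b]" using Qx' suf Cu by (metis append.assoc append_Cons append_Nil)
  have Px'C: "sublist (P x') (C @ [u])"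
    using Px' Cu sublist_append_rightI[of "pre @ [a1]" suf']
      by (auto intro: sublist_order.order.trans)
  have "C \<noteq> []"
    using sublist_length_le[OF Px'C] pear_length[OF pear xV(4)] by auto
  then have ua: "u \<noteq> a" "b \<noteq> a"
    using hd pear_distinct[OF pear xV(4)] by (cases C; auto simp: Qx'C)+
  let ?P = "P(x' := rev (P x'))" and ?Q = "Q(x' := rev (Q x'))"
  let ?P2 = "?P(x := rev (?P x))" and ?Q2 = "?Q(x := rev (?Q x))"
  have pear1: "pear G ?P ?Q" by (rule pear_flip[OF pear G])
  have pear2: "pear G ?P2 ?Q2" by (rule pear_flip[OF pear1 G])
  have Q1: "?Q x' = b # u # rev C" "?Q2 x' = b # u # rev C" using \<open>x \<noteq> x'\<close> by (auto simp: Qx'C)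
  have "sublist (rev (P x')) (rev (C @ [u]))" using Px'C by (simp only: sublist_rev)
  then have P1: "sublist (?P x') (u # rev C)" "sublist (?P2 x') (u # rev C)"
    using \<open>x \<noteq> x'\<close> by auto
  \<comment> \<open>Read from \<open>b\<close>, the ear \<open>Q x'\<close> now provides the edge to
    contract. \<open>imp2\<close> reverses \<open>Q x\<close> as well, for the case that
    \<open>P x\<close> comes after \<open>u\<close>. The unfolding returns both conclusions to the
    given \<open>Q\<close>.\<close>
  note imp1 = ear_end_improvable[OF G pear1 yx' yx not_sym[OF \<open>x \<noteq> x'\<close>] Q1(1) P1(1), unfolded improvable_flip]
  note imp2 = ear_end_improvable[OF G pear2 yx' yx not_sym[OF \<open>x \<noteq> x'\<close>] Q1(2) P1(2), unfolded improvable_flip]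
  show ?thesis
  proof (cases "u \<in> set (Q x)")
    case False
    then show ?thesis using imp1 \<open>x \<noteq> x'\<close> by simp
  next
    case True
    then obtain pre2 suf2 where s: "Q x = pre2 @ u # suf2" by (meson split_list)
    have "u \<notin> internal_verts (P x)"
      using pear_sibling[OF pear yx yx' \<open>x \<noteq> x'\<close>] by (auto simp: Qx'C)
    then have "sublist (P x) (pre2 @ [u]) \<or> sublist (P x) (u # suf2)"
      using sublist_around_split[of pre2 u suf2 "P x"] pear_distinct[OF pear xV(2)]
        pear_sublist[OF pear xV(2)] s by auto
    then show ?thesis
    proof
      assume "sublist (P x) (pre2 @ [u])"
      moreover have "hd (Q x) \<noteq> b" using ua by (simp add: Qx)
      ultimately show ?thesis using imp1 s \<open>x \<noteq> x'\<close> by auto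
    next
      assume Pxu: "sublist (P x) (u # suf2)"
      obtain A where A: "pre2 = a # A" using s ua by (cases pre2) (auto simp: Qx)
      show ?thesis
      proof (cases "last (Q x) = b")
        case True
        then show ?thesis
          using ear_reroute[OF G pear yx yx' \<open>x \<noteq> x'\<close> _ Pxu Qx'C Px'C hd] s A by simp
      next
        case False
        have "sublist (rev (P x)) (rev (u # suf2))" using Pxu by (simp only: sublist_rev)
        moreover have "hd (rev (Q x)) \<noteq> b" using False by (simp add: hd_rev)
        ultimately show ?thesis using imp2 \<open>x \<noteq> x'\<close> by (auto simp: s)
      qed
    qed
  qed
qed

text \<open>\<open>a1\<close> is on \<open>Q x\<close>, so condition (3) keeps it out of the
  interior of \<open>P x'\<close>, which then lies on one side of it. Reversing \<open>Q x'\<close>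
  if necessary puts \<open>P x'\<close> before \<open>a1\<close>.\<close>

lemma ear_with_margin_improvable:
  assumes G: "pair_graph G" and pear: "pear G P Q"
    and yx: "(y, x) \<in> R" and yx': "(y, x') \<in> R" and "x \<noteq> x'"
    and Qx: "Q x = a # a1 # rest" and Px: "sublist (P x) (a1 # rest)"
  shows "improvable G Q"
proof (cases "a1 \<in> set (Q x')")
  case False
  then show ?thesis using ear_end_improvable[OF G pear yx yx' \<open>x \<noteq> x'\<close> Qx Px] by blast
next
  case True
  note xV = in_V[OF yx] in_V[OF yx']
  obtain pre suf where s: "Q x' = pre @ a1 # suf" using True by (meson split_list)
  have "a1 \<notin> internal_verts (P x')"
    using pear_sibling[OF pear yx' yx] \<open>x \<noteq> x'\<close> by (auto simp: Qx)
  then have "sublist (P x') (pre @ [a1]) \<or> sublist (P x') (a1 # suf)"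
    using sublist_around_split[of pre a1 suf "P x'"] pear_distinct[OF pear xV(4)]
      pear_sublist[OF pear xV(4)] s by auto
  then show ?thesis
  proof
    assume "sublist (P x') (pre @ [a1])"
    then show ?thesis using common_ear_end_improvable[OF G pear yx yx' \<open>x \<noteq> x'\<close> Qx Px s] by blast
  next
    assume "sublist (P x') (a1 # suf)"
    then have "sublist (rev (P x')) (rev (a1 # suf))" by (simp only: sublist_rev)
    then have "improvable G (Q(x' := rev (Q x')))"
      using common_ear_end_improvable[OF G pear_flip[OF pear G, of x'] yx yx' \<open>x \<noteq> x'\<close>, of a a1 rest "rev suf" "rev pre"]
        Qx Px s \<open>x \<noteq> x'\<close> by simp
    then show ?thesis by (simp add: improvable_flip)
  qed
qed

text \<open>By condition (3) the common vertex \<open>c\<close> is not internal to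
  \<open>P x\<close>, so \<open>P x\<close> lies on one side of it. As \<open>c\<close> is internal
  to \<open>Q x\<close>, there is an edge of \<open>Q x\<close> beyond \<open>c\<close>, outside
  \<open>P x\<close>, at the other end.\<close>

lemma meeting_siblings_improvable:
  assumes G: "pair_graph G" and pear: "pear G P Q"
    and yx: "(y, x) \<in> R" and yx': "(y, x') \<in> R" and "x \<noteq> x'"
    and c: "c \<in> internal_verts (Q x)" "c \<in> set (Q x')"
  shows "improvable G Q"
proof -
  have xV: "x \<in> V" using in_V[OF yx] by blast
  obtain C D where s: "Q x = C @ c # D" using c(1)
    by (auto simp: internal_verts_def dest: split_list)
  have CD: "C \<noteq> []" "D \<noteq> []" using c(1) by (auto simp: internal_verts_def s)
  have "c \<notin> internal_verts (P x)"
    using pear_sibling[OF pear yx yx' \<open>x \<noteq> x'\<close>] c by blast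
  then have "sublist (P x) (C @ [c]) \<or> sublist (P x) (c # D)"
    using sublist_around_split[of C c D "P x"] pear_distinct[OF pear xV]
      pear_sublist[OF pear xV] s by auto
  then show ?thesis
  proof
    assume P: "sublist (P x) (c # D)"
    obtain a C' where C: "C = a # C'" using CD by (cases C) auto
    then obtain a1 rest where r: "C' @ c # D = a1 # rest" by (cases C') auto
    have "sublist (P x) (a1 # rest)"
      using P sublist_append_leftI[of "c # D" C'] unfolding r by (rule sublist_order.order.trans)
    then show ?thesis
      using ear_with_margin_improvable[OF G pear yx yx' \<open>x \<noteq> x'\<close>, of a a1 rest] s C r by simp
  next
    assume P: "sublist (P x) (C @ [c])"
    obtain a D' where D: "rev D = a # D'" using CD by (cases "rev D") auto
    then obtain a1 rest where r: "D' @ c # rev C = a1 # rest" by (cases D') auto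
    have "sublist (rev (P x)) (rev (C @ [c]))" using P by (simp only: sublist_rev)
    then have "sublist (rev (P x)) (c # rev C)" by simp
    then have "sublist (rev (P x)) (a1 # rest)"
      using sublist_append_leftI[of "c # rev C" D'] unfolding r by (rule sublist_order.order.trans)
    then have "improvable G (Q(x := rev (Q x)))"
      using ear_with_margin_improvable[OF G pear_flip[OF pear G, of x] yx yx' \<open>x \<noteq> x'\<close>, of a a1 rest] s D r by simp
    then show ?thesis by (simp add: improvable_flip)
  qed
qed

section \<open>Termination and passage to ear trees\<close>

lemma pear_with_disjoint_siblings_exists:
  assumes "pair_graph G" "pear G P Q"
  shows "\<exists>H P' Q'. contract_step\<^sup>*\<^sup>* G H \<and> pair_graph H \<and> pear H P' Q' \<and>
           (\<forall>y x x' v. (y, x) \<in> R \<longrightarrow> (y, x') \<in> R \<longrightarrow> x \<noteq> x' \<longrightarrow> v \<in> internal_verts (Q' x) \<longrightarrow> v \<notin> set (Q' x'))"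
  using assms
proof (induction "weight Q" arbitrary: G P Q rule: less_induct)
  case less
  show ?case
  proof (cases "improvable G Q")
    case True
    then obtain G' P' Q'
      where "contract_step\<^sup>*\<^sup>* G G'" "pair_graph G'" "pear G' P' Q'" "weight Q' < weight Q"
      unfolding improvable_def by blast
    then show ?thesis using less.hyps[of Q' G' P'] by (meson rtranclp_trans)
  next
    case False
    \<comment> \<open>When no improvement is left, no two siblings meet, and \<open>G\<close> itself
      serves as \<open>H\<close>.\<close>
    then show ?thesis using less.prems meeting_siblings_improvable[OF less.prems] by blast
  qed
qed

text \<open>The pear condition leaves only a sibling \<open>x'\<close> and the nodes below it. In
  the latter case separation puts \<open>v\<close> on \<open>P x'\<close>, hence on
  \<open>Q x'\<close>, against \<open>disj\<close>.\<close>

lemma disjoint_siblings_avoid: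
  assumes pear: "pear G P Q"
    and disj: "\<And>y x x' v. (y, x) \<in> R \<Longrightarrow> (y, x') \<in> R \<Longrightarrow> x \<noteq> x' \<Longrightarrow> v \<in> internal_verts (Q x) \<Longrightarrow> v \<notin> set (Q x')"
    and yx: "(y, x) \<in> R" and z: "z \<in> V" "z \<noteq> x" "(x, z) \<notin> R\<^sup>+" and v: "v \<in> internal_verts (Q x)"
  shows "v \<notin> set (Q z)"
proof
  assume vz: "v \<in> set (Q z)"
  then have "(y, z) \<in> R\<^sup>+" using pear_internal[OF pear yx z(1) _ v] by blast
  then obtain x' where x': "(y, x') \<in> R" "z = x' \<or> (x', z) \<in> R\<^sup>+"
    by (cases rule: converse_tranclE) blast+
  then have "x' \<noteq> x" using z by blast
  then have "(x', z) \<in> R\<^sup>+" using disj[OF yx x'(1)] v vz x'(2) by blast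
  then have "v \<in> set (P x')"
    using pear_common_vertex[OF pear _ in_V(2)[OF yx] sibling_not_descendant[OF x'(1) yx] vz] v
    by (simp add: internal_verts_def)
  then show False
    using disj[OF yx x'(1)] \<open>x' \<noteq> x\<close> v pear_P_subset[OF pear in_V(2)[OF x'(1)]] by blast
qed

text \<open>The outer paths will be the ears, so cleanness must pass from the ends of
  \<open>P y\<close> to those of \<open>Q y\<close>. An end of \<open>Q y\<close> on a child ear
  lies on \<open>P y\<close> by separation and is thus the end of \<open>P y\<close> on the same
  side.\<close>

lemma pear_clean_outer:
  assumes pear: "pear G P Q" and y: "y \<in> V"
  shows "\<exists>e \<in> {hd (Q y), last (Q y)}. \<forall>x. (y, x) \<in> R \<longrightarrow> e \<notin> set (Q x)"
proof -
  obtain A B where Q: "Q y = A @ P y @ B" using pear_sublist[OF pear y] by (auto simp: sublist_def)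
  have d: "distinct (A @ P y @ B)" using pear_distinct[OF pear y] Q by simp
  have ne: "P y \<noteq> []" "Q y \<noteq> []" using pear_nonempty[OF pear y] by auto
  have inP: "e \<in> set (P y)" if "(y, x) \<in> R" "e \<in> set (Q x)" "e \<in> set (Q y)" for e x
    using pear_common_vertex[OF pear r_into_trancl[OF that(1)] y not_descendant_self that(2,3)] .
  have h: "hd (Q y) \<in> set (P y) \<Longrightarrow> hd (Q y) = hd (P y)" using d ne by (cases A) (auto simp: Q)
  have l: "last (Q y) \<in> set (P y) \<Longrightarrow> last (Q y) = last (P y)" using d ne
    by (cases B rule: rev_cases) (auto simp: Q)
  show ?thesis using pear_clean[OF pear y] inP h l ne
    by (metis hd_in_set insert_iff last_in_set singletonD)
qed

end

section \<open>Rooted trees\<close>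

text \<open>Two paths that part after \<open>u\<close> and first meet again at \<open>w\<close>
  enclose a cycle through \<open>u\<close>; otherwise the common first vertex is removed and the
  induction continues.\<close>

lemma undirected_tree_path_unique:
  assumes T: "undirected_tree T"
    and "vpath p (with_proj T)" "vpath q (with_proj T)" "hd p = hd q" "last p = last q"
  shows "p = q"
  using assms(2-)
proof (induct p arbitrary: q)
  case Nil
  then show ?case by (simp add: vpath_with_proj_iff)
next
  case (Cons u p)
  interpret pair_graph T using T by (simp add: undirected_tree_def)
  obtain q' where q: "q = u # q'" using Cons.prems by (cases q) (auto simp: vpath_with_proj_iff)
  show ?case
  proof (cases "p = [] \<or> q' = []")
    case True
    then show ?thesis using Cons.prems by (auto simp: q vpath_with_proj_iff split: if_splits)
  next
    case False
    then have vp: "vpath p (with_proj T)" "vpath q' (with_proj T)" "last p = last q'"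
      "(u, hd p) \<in> parcs T" "(u, hd q') \<in> parcs T" "u \<notin> set p" "u \<notin> set q'"
      using Cons.prems by (auto simp: q vpath_with_proj_iff successively_Cons)
    have "hd p = hd q'"
    proof (rule ccontr)
      assume hd: "hd p \<noteq> hd q'"
      have "\<exists>w \<in> set p. w \<in> set q'" using vp(3) False last_in_set by metis
      from split_list_first_prop[OF this] obtain p1 w p2
        where p: "p = p1 @ w # p2" "w \<in> set q'" "\<forall>x \<in> set p1. x \<notin> set q'" by blast
      obtain q1 q2 where q': "q' = q1 @ w # q2" using p(2) by (meson split_list)
      \<comment> \<open>If both were empty, \<open>w\<close> would be the second vertex of both
        paths. This gives the cycle its third vertex.\<close>
      have ne: "p1 \<noteq> [] \<or> q1 \<noteq> []" using hd by (auto simp: p q')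
      define c where "c = (u # p1 @ [w]) @ rev q1"
      have 1: "vpath (p1 @ [w]) (with_proj T)" "vpath (q1 @ [w]) (with_proj T)"
        using vp(1,2) sublist_append_rightI[of "p1 @ [w]" p2] sublist_append_rightI[of "q1 @ [w]" q2]
        by (auto simp: p q' intro: vpath_sublist)
      have 2: "vpath (w # rev q1) (with_proj T)" using vpath_rev[OF pair_graph 1(2)] by simp
      have "distinct c" using vp(1,2,6,7) p(3) by (auto simp: c_def vpath_with_proj_iff p q')
      moreover have "set c \<subseteq> pverts T"
        using 1 Cons.prems(1) by (auto simp: c_def vpath_with_proj_iff)
      moreover have "successively (\<lambda>u v. (u, v) \<in> parcs T) c"
      proof -
        let ?s = "successively (\<lambda>u v. (u, v) \<in> parcs T)"
        have "(u, hd (p1 @ [w])) \<in> parcs T" using vp(4) by (cases p1) (auto simp: p)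
        then have "?s (u # p1 @ [w])" using 1(1)
          by (auto simp: vpath_with_proj_iff successively_Cons)
        moreover have "q1 \<noteq> [] \<Longrightarrow> (w, hd (rev q1)) \<in> parcs T" "?s (rev q1)"
          using 2 unfolding vpath_with_proj_iff successively_Cons by auto
        ultimately show ?thesis unfolding c_def by (subst successively_append_iff) auto
      qed
      ultimately have "vpath c (with_proj T)" by (simp add: vpath_with_proj_iff c_def)
      moreover have "length c \<ge> 3" using ne by (cases p1; cases q1) (auto simp: c_def)
      moreover have "(last c, hd c) \<in> parcs T"
        using vp(5) arcs_symmetric by (cases q1) (auto simp: c_def q')
      ultimately show False using T by (auto simp: undirected_tree_def)
    qed
    then show ?thesis using Cons.hyps[OF vp(1,2) _ vp(3)] q by blast
  qed
qed


definition child_rel :: "'b pair_pre_digraph \<Rightarrow> 'b \<Rightarrow> 'b rel" where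
  "child_rel T r = {(y, x). y \<in> pverts T \<and> x \<in> children T r y}"

context
  fixes T :: "'b pair_pre_digraph" and r :: 'b
  assumes tree: "undirected_tree T" and root: "r \<in> pverts T"
begin

lemma pair_graph_tree: "pair_graph T"
  using tree by (simp add: undirected_tree_def)

lemma root_path_exists:
  assumes "z \<in> pverts T"
  obtains p where "vpath p (with_proj T)" "hd p = r" "last p = z"
proof -
  interpret pair_graph T by (rule pair_graph_tree)
  have "strongly_connected (with_proj T)"
    using tree sym_arcs
      by (intro symmetric_connected_imp_strongly_connected) (auto simp: undirected_tree_def)
  then have "r \<rightarrow>\<^sup>*\<^bsub>with_proj T\<^esub> z" using root assms by (auto simp: strongly_connected_def)
  then show ?thesis using that unfolding reachable_vpath_conv by blast
qed

lemma root_path_unique: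
  "vpath p (with_proj T) \<Longrightarrow> vpath q (with_proj T) \<Longrightarrow> hd p = r \<Longrightarrow> hd q = r \<Longrightarrow> last p = last q \<Longrightarrow> p = q"
  using undirected_tree_path_unique[OF tree] by metis

text \<open>Brings out the parent as the last but one vertex of a root path. A root path to
  \<open>x\<close> through \<open>y\<close> can be cut at \<open>y\<close> and continued by the arc
  to \<open>x\<close>.\<close>

lemma child_rel_iff:
  "(y, x) \<in> child_rel T r \<longleftrightarrow> (\<exists>q. vpath (q @ [y, x]) (with_proj T) \<and> hd (q @ [y]) = r)"
proof
  assume "(y, x) \<in> child_rel T r"
  then obtain p where p: "vpath p (with_proj T)" "hd p = r" "last p = x" "y \<in> set p" "(y, x) \<in> parcs T"
    by (auto simp: child_rel_def children_def subtree_verts_def)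
  interpret pair_graph T by (rule pair_graph_tree)
  have "x \<noteq> y" using no_loops' p(5) by blast
  obtain p1 p2 where s: "p = p1 @ y # p2" using p(4) by (meson split_list)
  then have "p2 \<noteq> []" using p(3) \<open>x \<noteq> y\<close> by auto
  then have "x \<in> set p2" using p(3) s by auto
  then have "vpath (p1 @ [y, x]) (with_proj T)"
    using p(1,5) by (auto simp: s vpath_with_proj_iff successively_append_iff)
  moreover have "hd (p1 @ [y]) = r" using p(2) by (simp add: s hd_append split: if_splits)
  ultimately show "\<exists>q. vpath (q @ [y, x]) (with_proj T) \<and> hd (q @ [y]) = r" by blast
next
  assume "\<exists>q. vpath (q @ [y, x]) (with_proj T) \<and> hd (q @ [y]) = r"
  then obtain q where q: "vpath (q @ [y, x]) (with_proj T)" "hd (q @ [y]) = r" by blast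
  then have "(y, x) \<in> parcs T" "y \<in> pverts T"
    by (auto simp: vpath_with_proj_iff successively_append_iff)
  moreover have "hd (q @ [y, x]) = r" using q(2) by (simp add: hd_append split: if_splits)
  then have "x \<in> subtree_verts T r y" using q(1)
    by (auto simp: subtree_verts_def intro!: exI[of _ "q @ [y, x]"])
  ultimately show "(y, x) \<in> child_rel T r" by (simp add: child_rel_def children_def)
qed

lemma root_path_snoc:
  assumes "(y, x) \<in> child_rel T r" "vpath p (with_proj T)" "hd p = r" "last p = y"
  shows "vpath (p @ [x]) (with_proj T)"
proof -
  obtain q where q: "vpath (q @ [y, x]) (with_proj T)" "hd (q @ [y]) = r"
    using assms(1) child_rel_iff by blast
  then have "vpath (q @ [y]) (with_proj T)"
    by (auto simp: vpath_with_proj_iff successively_append_iff)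
  then have "p = q @ [y]" using assms q(2) by (intro root_path_unique) auto
  then show ?thesis using q(1) by simp
qed

text \<open>Links the definition by root paths with descent: consecutive vertices of a root path are
  parent and child, and root paths extend along such pairs.\<close>

lemma subtree_verts_eq:
  assumes "x \<in> pverts T"
  shows "subtree_verts T r x = {z. (x, z) \<in> (child_rel T r)\<^sup>*}"
proof (intro equalityI subsetI)
  fix z assume "z \<in> subtree_verts T r x"
  then obtain p where p: "vpath p (with_proj T)" "hd p = r" "last p = z" "x \<in> set p"
    by (auto simp: subtree_verts_def)
  obtain p1 p2 where "p = p1 @ x # p2" using p(4) by (meson split_list)
  then have "(x, z) \<in> (child_rel T r)\<^sup>*" using p(1-3)
  proof (induct p2 arbitrary: p z rule: rev_induct)
    case (snoc w p2)
    obtain q w' where q: "p1 @ x # p2 = q @ [w']"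
      by (metis append_is_Nil_conv list.distinct(1) rev_exhaust)
    have hd: "hd (p1 @ x # p2) = r" using snoc.prems by (simp add: hd_append split: if_splits)
    have vp: "vpath (p1 @ x # p2) (with_proj T)"
      using snoc.prems(1,2)
        by (auto intro: vpath_sublist[of p] sublist_append_rightI[of "p1 @ x # p2" "[w]"])
    have w': "last (p1 @ x # p2) = w'" unfolding q by simp
    have "w = z" using snoc.prems by simp
    have "p = q @ [w', z]" using snoc.prems(1) q \<open>w = z\<close>
      by (metis append.assoc append_Cons append_Nil)
    then have "(w', z) \<in> child_rel T r" using snoc.prems(2) hd unfolding child_rel_iff q by blast
    moreover have "(x, w') \<in> (child_rel T r)\<^sup>*" using snoc.hyps[OF refl vp hd w'] .
    ultimately show ?case by simp
  qed simp
  then show "z \<in> {z. (x, z) \<in> (child_rel T r)\<^sup>*}" by simp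
next
  fix z assume "z \<in> {z. (x, z) \<in> (child_rel T r)\<^sup>*}"
  then have "(x, z) \<in> (child_rel T r)\<^sup>*" by simp
  then show "z \<in> subtree_verts T r x"
  proof induct
    case base
    obtain p where "vpath p (with_proj T)" "hd p = r" "last p = x"
      using root_path_exists[OF assms] .
    moreover then have "x \<in> set p" by (auto simp: vpath_with_proj_iff)
    ultimately show ?case by (auto simp: subtree_verts_def)
  next
    case (step w z)
    then obtain p where p: "vpath p (with_proj T)" "hd p = r" "last p = w" "x \<in> set p"
      by (auto simp: subtree_verts_def)
    have "p \<noteq> []" using p(4) by auto
    then show ?case using root_path_snoc[OF step(2) p(1-3)] p
      by (auto simp: subtree_verts_def intro!: exI[of _ "p @ [z]"])
  qed
qed

text \<open>Depth increases by one from parent to child, where depth is the number of vertices of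
  the root path, well defined by uniqueness.\<close>

lemma acyclic_child_rel: "acyclic (child_rel T r)"
proof -
  define len where "len z = (THE n. \<exists>p. vpath p (with_proj T) \<and> hd p = r \<and> last p = z \<and> n = length p)" for z
  have len: "len z = length p" if "vpath p (with_proj T)" "hd p = r" "last p = z" for p z
    unfolding len_def using that root_path_unique by (intro the_equality) blast+
  have "child_rel T r \<subseteq> Wellfounded.measure len"
  proof safe
    fix y x assume yx: "(y, x) \<in> child_rel T r"
    then obtain q where q: "vpath (q @ [y, x]) (with_proj T)" "hd (q @ [y]) = r" using child_rel_iff
      by blast
    then have "vpath (q @ [y]) (with_proj T)"
      by (auto simp: vpath_with_proj_iff successively_append_iff)
    moreover have "hd (q @ [y, x]) = r" using q(2) by (simp add: hd_append split: if_splits)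
    ultimately have "len y = length (q @ [y])" "len x = length (q @ [y, x])"
      using q len[of "q @ [y]" y] len[of "q @ [y, x]" x] by auto
    then show "(y, x) \<in> Wellfounded.measure len" by simp
  qed
  then show ?thesis using wf_subset wf_measure wf_acyclic by blast
qed

lemma binary_forest_child_rel:
  assumes "\<forall>y \<in> pverts T. card (children T r y) \<le> 2"
  shows "binary_forest (pverts T) (child_rel T r)"
proof -
  interpret pair_graph T by (rule pair_graph_tree)
  show ?thesis
  proof
    show "finite (pverts T)" by (rule pair_finite_verts)
    show "child_rel T r \<subseteq> pverts T \<times> pverts T"
      using wellformed' by (auto simp: child_rel_def children_def)
    show "acyclic (child_rel T r)" by (rule acyclic_child_rel)
    fix y y' x assume "(y, x) \<in> child_rel T r" "(y', x) \<in> child_rel T r"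
    then obtain q q' where q: "vpath (q @ [y, x]) (with_proj T)" "hd (q @ [y]) = r"
      "vpath (q' @ [y', x]) (with_proj T)" "hd (q' @ [y']) = r" unfolding child_rel_iff by blast
    \<comment> \<open>Both lists are root paths to \<open>x\<close>.\<close>
    then have "q @ [y, x] = q' @ [y', x]"
      by (intro root_path_unique) (auto simp: hd_append split: if_splits)
    then show "y = y'" by simp
  next
    fix y x x' z
    assume *: "(y, x) \<in> child_rel T r" "(y, x') \<in> child_rel T r" "x \<noteq> x'" "(y, z) \<in> child_rel T r"
    \<comment> \<open>Finiteness matters: \<open>card\<close> of an infinite set is 0 and would meet
      the bound trivially.\<close>
    have "finite (children T r y)"
      using wellformed' by (auto simp: children_def intro: finite_subset[OF _ pair_finite_verts])
    then have "card {x, x', z} \<le> card (children T r y)"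
      using * by (intro card_mono) (auto simp: child_rel_def)
    then have "card {x, x', z} \<le> 2" using assms * by (fastforce simp: child_rel_def)
    then show "z = x \<or> z = x'" using *(3) by (auto simp: card_insert_if split: if_splits)
  qed
qed

end

section \<open>The minor and the conclusion\<close>

lemma is_minor_contraction:
  assumes "pair_graph G" "contract_step\<^sup>*\<^sup>* G H" "pair_graph H"
  shows "is_minor H G"
proof -
  interpret G: pair_graph G by fact
  interpret H: pair_graph H by fact
  \<comment> \<open>The subgraph in \<open>is_minor\<close> is \<open>G\<close> itself, and the
    isomorphism is the identity.\<close>
  have "digraph_iso (with_proj H) (with_proj H)"
    unfolding digraph_iso_def H.digraph_isomorphism_def
    by (rule exI[of _ "\<lparr>iso_verts = id, iso_arcs = id, iso_head = snd, iso_tail = fst\<rparr>"])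
      (auto simp: app_iso_def with_proj_def H.wf_digraph_axioms[unfolded with_proj_def])
  then show ?thesis
    unfolding is_minor_def using assms G.subgraph_refl by blast
qed

theorem theorem4p1:
  fixes G :: "'a pair_pre_digraph"
    and T :: "'b pair_pre_digraph" and r :: 'b
    and B :: "'b \<Rightarrow> 'a list \<times> 'a list"
  assumes "pair_graph G"
    and "clean_binary_pear_tree G T r B"
  shows "\<exists>(H :: 'a pair_pre_digraph) (P :: 'b \<Rightarrow> 'a list).
           pair_graph H \<and> is_minor H G \<and> clean_binary_ear_tree H T r P"
proof -
  define P where "P = (\<lambda>x. fst (B x))"
  define Q where "Q = (\<lambda>x. snd (B x))"
  \<comment> \<open>Containment of path graphs ignores orientation, whereas \<open>sublist\<close>
    does not; \<open>Q'\<close> turns each outer path to agree with its inner one.\<close>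
  define Q' where "Q' = (\<lambda>x. if sublist (P x) (Q x) then Q x else rev (Q x))"
  define R where "R = child_rel T r"
  have bp: "binary_pear_tree G T r B" and
    clean: "\<And>y. y \<in> pverts T \<Longrightarrow> children T r y \<noteq> {} \<Longrightarrow>
      \<exists>e \<in> {hd (P y), last (P y)}. \<forall>x \<in> children T r y. e \<notin> set (Q x)"
    using assms(2) by (auto simp: clean_binary_pear_tree_def P_def Q_def)
  then have bt: "binary_tree T r" by (simp add: binary_pear_tree_def)
  then have T: "undirected_tree T" "r \<in> pverts T" "\<forall>y \<in> pverts T. card (children T r y) \<le> 2"
    by (auto simp: binary_tree_def)
  interpret binary_forest "pverts T" R
    unfolding R_def by (rule binary_forest_child_rel[OF T])
  have R_iff: "(y, x) \<in> R \<longleftrightarrow> y \<in> pverts T \<and> x \<in> children T r y" for y x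
    by (simp add: R_def child_rel_def)
  have subtree: "z \<in> subtree_verts T r x \<longleftrightarrow> z = x \<or> (x, z) \<in> R\<^sup>+" if "x \<in> pverts T" for x z
    unfolding subtree_verts_eq[OF T(1,2) that] R_def by (auto simp: rtrancl_eq_or_trancl)
  \<comment> \<open>Lists count vertices, so two edges become the bound 3.\<close>
  have vp: "vpath (P x) (with_proj G)" "length (P x) \<ge> 3" "vpath (Q x) (with_proj G)"
    "subgraph (with_proj (path_graph (P x))) (with_proj (path_graph (Q x)))" if "x \<in> pverts T" for x
    using bp that by (auto simp: binary_pear_tree_def Let_def P_def Q_def)
  have kids: "is_ear G (path_graph (P y)) (Q x) \<and>
      (children T r y = {x} \<longrightarrow>
        internal_verts (Q x) \<inter> (\<Union>z \<in> pverts T - subtree_verts T r x. set (Q z)) = {}) \<and>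
      (\<forall>x' \<in> children T r y. x' \<noteq> x \<longrightarrow>
        internal_verts (Q x) \<inter>
          (\<Union>z \<in> pverts T - (subtree_verts T r x \<union> subtree_verts T r x'). set (Q z)) = {} \<and>
        internal_verts (P x) \<inter> set (Q x') = {})" if "(y, x) \<in> R" for y x
    using bp that unfolding binary_pear_tree_def Let_def P_def Q_def R_iff by blast
  have ear: "is_ear G (path_graph (P y)) (Q x)" if "(y, x) \<in> R" for y x
    using kids[OF that] by blast
  have single: "internal_verts (Q x) \<inter> set (Q z) = {}"
    if "(y, x) \<in> R" "children T r y = {x}" "z \<in> pverts T" "z \<notin> subtree_verts T r x" for y x z
    using kids[OF that(1)] that(2-) by blast
  have double: "internal_verts (Q x) \<inter> set (Q z) = {}"
    if "(y, x) \<in> R" "(y, x') \<in> R" "x \<noteq> x'" "z \<in> pverts T" "z \<notin> subtree_verts T r x" "z \<notin> subtree_verts T r x'"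
    for y x x' z
  proof -
    have "x' \<in> children T r y" using that(2) by (simp add: R_iff)
    then have "internal_verts (Q x) \<inter>
        (\<Union>z \<in> pverts T - (subtree_verts T r x \<union> subtree_verts T r x'). set (Q z)) = {}"
      using conjunct2[OF conjunct2[OF kids[OF that(1)]]] that(3) by simp
    moreover have "set (Q z) \<subseteq>
        (\<Union>z \<in> pverts T - (subtree_verts T r x \<union> subtree_verts T r x'). set (Q z))"
      using that(4-6) by (intro UN_upper) simp
    ultimately show ?thesis by (metis Int_mono bot.extremum_uniqueI order_refl)
  qed
  have sibling: "internal_verts (P x) \<inter> set (Q x') = {}"
    if "(y, x) \<in> R" "(y, x') \<in> R" "x \<noteq> x'" for y x x'
    using conjunct2[OF conjunct2[OF kids[OF that(1)]]] that(2,3) by (simp add: R_iff)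
  have setQ': "set (Q' x) = set (Q x)" "internal_verts (Q' x) = internal_verts (Q x)" for x
    by (auto simp: Q'_def)
  have "pear G P Q'"
  proof (rule pearI, goal_cases)
    case (1 x)
    then show ?case using vp(3) vpath_rev[OF assms(1)] by (auto simp: Q'_def)
  next
    case (2 x)
    then show ?case using vp(2) by blast
  next
    case (3 x)
    have "set (vwalk_arcs (P x)) \<subseteq> set (vwalk_arcs (Q x)) \<union> (set (vwalk_arcs (Q x)))\<inverse>"
      using vp(4)[OF 3] by (auto simp: subgraph_def path_graph_def)
    then have "sublist (P x) (Q x) \<or> sublist (P x) (rev (Q x))"
      using vp[OF 3] by (intro subpath_sublist) (auto simp: vpath_with_proj_iff)
    then show ?case by (auto simp: Q'_def)
  next
    case (4 y x)
    then show ?case using ear[OF 4]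
      by (auto simp: Q'_def is_ear_def path_graph_def hd_rev vpath_with_proj_iff)
  next
    case (5 y x)
    then show ?case using ear[OF 5]
      by (auto simp: Q'_def is_ear_def path_graph_def last_rev vpath_with_proj_iff)
  next
    case (6 y x z v)
    \<comment> \<open>A node not below \<open>y\<close> lies in no subtree of a child of
      \<open>y\<close>, so condition (2) applies to an only child and condition (3) to
      siblings.\<close>
    have desc: "z \<notin> subtree_verts T r k" if "(y, k) \<in> R" for k
      using subtree[OF in_V(2)[OF that]] 6(3) that by (auto dest: trancl_into_trancl2)
    have "internal_verts (Q x) \<inter> set (Q z) = {}"
    proof (cases "children T r y = {x}")
      case True
      then show ?thesis using single[OF 6(1) True 6(2)] desc[OF 6(1)] by blast
    next
      case False
      then obtain x' where "(y, x') \<in> R" "x \<noteq> x'" using 6(1) by (auto simp: R_iff)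
      then show ?thesis using double[OF 6(1) _ _ 6(2)] desc[OF 6(1)] desc by blast
    qed
    then show ?case using 6 setQ' by blast
  next
    case (7 y x x' v)
    then show ?case using sibling[OF 7(1-3)] setQ' by blast
  next
    case (8 y)
    show ?case
    proof (cases "children T r y = {}")
      case True
      then show ?thesis by (auto simp: R_iff)
    next
      case False
      then show ?thesis using clean[OF 8 False] by (simp add: R_iff setQ' 8 Ball_def)
    qed
  qed
  then obtain H P1 Q1 where H: "contract_step\<^sup>*\<^sup>* G H" "pair_graph H" and pear: "pear H P1 Q1"
    and disj: "\<And>y x x' v. (y, x) \<in> R \<Longrightarrow> (y, x') \<in> R \<Longrightarrow> x \<noteq> x' \<Longrightarrow> v \<in> internal_verts (Q1 x) \<Longrightarrow> v \<notin> set (Q1 x')"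
    using pear_with_disjoint_siblings_exists[OF assms(1)] by blast
  \<comment> \<open>The outer paths become the ears. Their ends lie on \<open>P1 y\<close>, hence on
    \<open>Q1 y\<close>.\<close>
  have "clean_binary_ear_tree H T r Q1"
    unfolding clean_binary_ear_tree_def binary_ear_tree_def
  proof (intro conjI ballI impI bt)
    fix x assume x: "x \<in> pverts T"
    show "vpath (Q1 x) (with_proj H)" by (rule pear_vpath[OF pear x])
    show "2 \<le> vwalk_length (Q1 x)"
      using sublist_length_le[OF pear_sublist[OF pear x]] pear_length[OF pear x] by simp
  next
    fix y x assume y: "y \<in> pverts T" and "x \<in> children T r y"
    then have yx: "(y, x) \<in> R" by (simp add: R_iff)
    then have x: "x \<in> pverts T" using in_V by blast
    show "is_ear H (path_graph (Q1 y)) (Q1 x)"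
      using pear_vpath[OF pear x] pear_hd[OF pear yx] pear_last[OF pear yx] pear_P_subset[OF pear y]
        pear_internal[OF pear yx y not_descendant_self]
      by (auto simp: is_ear_def path_graph_def)
    show "internal_verts (Q1 x) \<inter> (\<Union>z \<in> pverts T - subtree_verts T r x. set (Q1 z)) = {}"
    proof (rule Int_emptyI)
      fix v assume v: "v \<in> internal_verts (Q1 x)"
        and "v \<in> (\<Union>z \<in> pverts T - subtree_verts T r x. set (Q1 z))"
      then obtain z where z: "z \<in> pverts T" "z \<notin> subtree_verts T r x" "v \<in> set (Q1 z)" by blast
      then have "z \<noteq> x" "(x, z) \<notin> R\<^sup>+" using subtree[OF x] by simp_all
      from disjoint_siblings_avoid[OF pear disj yx z(1) this v] z(3) show False by simp
    qed
  next
    fix y assume y: "y \<in> pverts T"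
    show "\<exists>e \<in> {hd (Q1 y), last (Q1 y)}. \<forall>x \<in> children T r y. e \<notin> set (Q1 x)"
      using pear_clean_outer[OF pear y] by (simp add: R_iff y Ball_def)
  qed
  then show ?thesis using H is_minor_contraction[OF assms(1)] by blast
qed

end
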